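(* Let $\Gamma$ be the Hamming graph $H(m,n)$ on $\mathbb{Z}_n^m$, in which two vertices are adjacent iff their Hamming distance is $1$, and let $\Delta$ be the graph $H(m,n,m)$ on $\mathbb{Z}_n^m$, in which two vertices are adjacent iff their Hamming distance is $m$. Let $\overline{\Gamma}$ and $\overline{\Delta}$ be the complement graphs. Then: 1. Every singular endomorphism of $\Gamma$ is uniform of rank $n^k$ for some $1\le k\le m-1$, and its image is a $k$-layer. 2. Every singular endomorphism of $\Delta$ is uniform of rank $n^k$ for some $1\le k\le m-1$. 3. Every singular endomorphism of $\overline{\Gamma}$ is a colouring of rank $n^{m-1}$ (hence uniform). 4. Every singular endomorphism of $\overline{\Delta}$ is a colouring of rank $n^{m-1}$ (hence uniform).
   Context: The Hamming distance of two tuples in $\mathbb{Z}_n^m$ is the number of coordinates in which they differ. An endomorphism of a graph is a map from its vertex set to itself sending adjacent vertices to adjacent vertices; it is singular if it is not a bijection. The rank of a map is the size of its image. A map is uniform if all its kernel classes (nonempty fibres) have the same size. A $k$-layer in $\mathbb{Z}_n^m$ is a set of the form $a+\langle e_{i_1},\dots,e_{i_k}\rangle$ with $a\in\mathbb{Z}_n^m$, $i_1,\dots,i_k$ distinct, and $e_i$ the standard tuple with $1$ in position $i$ and $0$ elsewhere; equivalently, the set of all tuples with prescribed values in some fixed $m-k$ coordinates. An endomorphism is a colouring of rank $r$ if its image is a clique with $r$ vertices, so that its kernel classes are the colour classes of a proper vertex colouring with $r$ colours.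
   Formalization: The theorem is proved for m ≥ 2 and n ≥ 1, with n = 2 excluded in parts 1, 2 and 4: for m = 1 parts 3 and 4 fail (edgeless complements), and for n = 2 part 1 fails (C4 folds onto a 3-vertex path), part 2 fails for m ≥ 3 and part 4 fails (merge one antipodal pair). *)

theory Defs
  imports "HOL-Algebra.Algebra"
begin

text \<open>
  The group \<open>\<int>\<^sub>n\<^sup>m\<close>.  Coordinates are indexed by \<open>{..<m}\<close>, so for \<open>n > 0\<close> the carrier is
  \<open>{..<m} \<rightarrow>\<^sub>E {0..<int n}\<close>.  The group is written multiplicatively in HOL-Algebra, so
  \<open>a <#\<^bsub>G\<^esub> H\<close> below is the coset written additively as \<open>a + H\<close>.
\<close>
definition Zn_pow :: "nat \<Rightarrow> nat \<Rightarrow> (nat \<Rightarrow> int) monoid" where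
  "Zn_pow m n = product_group {..<m} (\<lambda>_. integer_mod_group n)"

text \<open>The reduction \<open>1 mod int n\<close> only matters for \<open>n = 1\<close>, where \<open>1 = 0\<close> in \<open>\<int>\<^sub>n\<close>.\<close>
definition std_tuple :: "nat \<Rightarrow> nat \<Rightarrow> nat \<Rightarrow> (nat \<Rightarrow> int)" where
  "std_tuple m n i = (\<lambda>j\<in>{..<m}. if j = i then 1 mod int n else 0)"

text \<open>The finite set \<open>I\<close> is the set \<open>{i\<^sub>1, \<dots>, i\<^sub>k}\<close> of the \<open>k\<close> distinct positions.\<close>
definition is_layer :: "nat \<Rightarrow> nat \<Rightarrow> nat \<Rightarrow> (nat \<Rightarrow> int) set \<Rightarrow> bool" where
  "is_layer m n k L \<longleftrightarrow>
     (\<exists>a \<in> carrier (Zn_pow m n). \<exists>I \<subseteq> {..<m}. card I = k \<and>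
        L = a <#\<^bsub>Zn_pow m n\<^esub> generate (Zn_pow m n) (std_tuple m n ` I))"

definition hamming_dist :: "nat \<Rightarrow> (nat \<Rightarrow> int) \<Rightarrow> (nat \<Rightarrow> int) \<Rightarrow> nat" where
  "hamming_dist m x y = card {i. i < m \<and> x i \<noteq> y i}"

text \<open>
  A graph is a vertex set with an adjacency relation.  All notions below consult the relation on
  the vertex set only.
\<close>
record 'a graph =
  verts :: "'a set"
  adj :: "'a \<Rightarrow> 'a \<Rightarrow> bool"

definition graph_compl :: "'a graph \<Rightarrow> 'a graph" where
  "graph_compl G = \<lparr>verts = verts G, adj = (\<lambda>x y. x \<noteq> y \<and> \<not> adj G x y)\<rparr>"

definition hamming_dist_graph :: "nat \<Rightarrow> nat \<Rightarrow> nat \<Rightarrow> (nat \<Rightarrow> int) graph" where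
  "hamming_dist_graph m n d =
     \<lparr>verts = carrier (Zn_pow m n), adj = (\<lambda>x y. hamming_dist m x y = d)\<rparr>"

abbreviation hamming_graph :: "nat \<Rightarrow> nat \<Rightarrow> (nat \<Rightarrow> int) graph" where
  "hamming_graph m n \<equiv> hamming_dist_graph m n 1"

definition is_clique :: "'a graph \<Rightarrow> 'a set \<Rightarrow> bool" where
  "is_clique G C \<longleftrightarrow> C \<subseteq> verts G \<and> (\<forall>x\<in>C. \<forall>y\<in>C. x \<noteq> y \<longrightarrow> adj G x y)"

definition endomorphism :: "'a graph \<Rightarrow> ('a \<Rightarrow> 'a) \<Rightarrow> bool" where
  "endomorphism G f \<longleftrightarrow> f \<in> verts G \<rightarrow> verts G \<and>
     (\<forall>x\<in>verts G. \<forall>y\<in>verts G. adj G x y \<longrightarrow> adj G (f x) (f y))"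

definition singular_endomorphism :: "'a graph \<Rightarrow> ('a \<Rightarrow> 'a) \<Rightarrow> bool" where
  "singular_endomorphism G f \<longleftrightarrow> endomorphism G f \<and> \<not> bij_betw f (verts G) (verts G)"

definition map_rank :: "'a set \<Rightarrow> ('a \<Rightarrow> 'b) \<Rightarrow> nat" where
  "map_rank A f = card (f ` A)"

definition kernel_classes :: "'a set \<Rightarrow> ('a \<Rightarrow> 'b) \<Rightarrow> 'a set set" where
  "kernel_classes A f = (\<lambda>y. {x \<in> A. f x = y}) ` (f ` A)"

definition uniform_map :: "'a set \<Rightarrow> ('a \<Rightarrow> 'b) \<Rightarrow> bool" where
  "uniform_map A f \<longleftrightarrow> (\<forall>K \<in> kernel_classes A f. \<forall>L \<in> kernel_classes A f. card K = card L)"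

definition colouring_of_rank :: "'a graph \<Rightarrow> nat \<Rightarrow> ('a \<Rightarrow> 'a) \<Rightarrow> bool" where
  "colouring_of_rank G r f \<longleftrightarrow>
     endomorphism G f \<and> is_clique G (f ` verts G) \<and> map_rank (verts G) f = r"

end

theory Submission
  imports Defs
begin

text \<open>
  There are no singular maps for \<open>n = 1\<close>, and the arguments for \<open>\<Gamma>\<close>, \<open>\<Delta>\<close> and the complement of \<open>\<Delta>\<close>
  use that three letters leave one that avoids any two given ones.

  For \<open>\<Gamma>\<close>, maximal cliques are lines, so an endomorphism maps lines to lines, and the direction of the
  image of a line depends only on the direction of the line.  Choosing one coordinate from each
  fibre of the induced map on directions gives layers that are mapped bijectively onto the image.

  For \<open>\<Delta>\<close>, call a set exact if it meets each maximal clique of \<open>\<Delta>\<close> in one point.  Swapping one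
  coordinate between two members of such a clique shows that the indicator function of an exact set
  is a sum of functions of single coordinates; being 0-1 valued, it depends on only one of them.
  Colour classes of proper \<open>n\<close>-colourings of \<open>\<Delta>\<close> are exact, so each coordinate of an endomorphism
  depends on one coordinate of the argument.  For the complement of \<open>\<Delta>\<close>, images of hyperplanes are
  exact by counting, hence are hyperplanes, and the way hyperplanes intersect forces all of them to
  have the same image if the map is not injective.

  For the complement of \<open>\<Gamma>\<close>, counting shows that preimages of lines are lines, so a fibre with two
  elements is a line; vertices adjacent to its image have empty fibre, and this propagates along
  the graph.
\<close>

section \<open>Words and layers\<close>

text \<open>Adjacency in all four graphs depends only on where two words differ, so the alphabet is
  an arbitrary finite set; the group structure returns only for \<open>is_layer\<close>.\<close>

locale words =
  fixes I :: "'i set" and A :: "'a set"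
  assumes finite_I: "finite I" and finite_A: "finite A" and A_nonempty: "A \<noteq> {}"
begin

definition V :: "('i \<Rightarrow> 'a) set" where
  "V = I \<rightarrow>\<^sub>E A"

text \<open>The set of positions is kept rather than its size: a singleton is the direction of an
  edge of \<Gamma>, and all of \<open>I\<close> means adjacency in \<Delta>.\<close>

definition diffs :: "('i \<Rightarrow> 'a) \<Rightarrow> ('i \<Rightarrow> 'a) \<Rightarrow> 'i set" where
  "diffs x y = {i \<in> I. x i \<noteq> y i}"

definition layer :: "'i set \<Rightarrow> ('i \<Rightarrow> 'a) \<Rightarrow> ('i \<Rightarrow> 'a) set" where
  "layer S x = {y \<in> V. diffs x y \<subseteq> S}"

lemma finite_V: "finite V"
  unfolding V_def by (intro finite_PiE finite_I finite_A)

lemma card_V: "card V = card A ^ card I"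
  unfolding V_def using finite_I by (simp add: card_PiE)

lemma V_nth_mem: "x \<in> V \<Longrightarrow> i \<in> I \<Longrightarrow> x i \<in> A"
  unfolding V_def by auto

lemma upd_in_V: "x \<in> V \<Longrightarrow> i \<in> I \<Longrightarrow> a \<in> A \<Longrightarrow> x(i := a) \<in> V"
  unfolding V_def by (auto simp: PiE_def extensional_def)

lemma V_eqI: "x \<in> V \<Longrightarrow> y \<in> V \<Longrightarrow> (\<And>i. i \<in> I \<Longrightarrow> x i = y i) \<Longrightarrow> x = y"
  unfolding V_def by (rule PiE_ext)

lemma diffs_empty_iff: "x \<in> V \<Longrightarrow> y \<in> V \<Longrightarrow> diffs x y = {} \<longleftrightarrow> x = y"
  unfolding diffs_def using V_eqI by auto

lemma diffs_commute: "diffs x y = diffs y x"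
  unfolding diffs_def by auto

lemma diffs_upd:
  "i \<in> I \<Longrightarrow> diffs (x(i := a)) (x(i := b)) = (if a = b then {} else {i})"
  unfolding diffs_def by auto

lemma diffs_eq_singleton_iff:
  "diffs x y = {i} \<longleftrightarrow> i \<in> I \<and> x i \<noteq> y i \<and> (\<forall>j\<in>I. j \<noteq> i \<longrightarrow> x j = y j)"
  unfolding diffs_def by blast

lemma in_layer_iff:
  "y \<in> layer S x \<longleftrightarrow> y \<in> V \<and> (\<forall>i\<in>I - S. x i = y i)"
  unfolding layer_def diffs_def by auto

lemma finite_layer: "finite (layer S x)"
  unfolding layer_def using finite_V by simp

lemma layer_subset_V: "layer S x \<subseteq> V"
  unfolding layer_def by auto

lemma card_layer:
  assumes "S \<subseteq> I" "x \<in> V"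
  shows "card (layer S x) = card A ^ card S"
proof -
  have "bij_betw (\<lambda>y. restrict y S) (layer S x) (S \<rightarrow>\<^sub>E A)"
  proof (rule bij_betwI[where g = "\<lambda>w i. if i \<in> S then w i else x i"])
    show "(\<lambda>y. restrict y S) \<in> layer S x \<rightarrow> S \<rightarrow>\<^sub>E A"
      using assms(1) by (auto simp: in_layer_iff V_nth_mem subset_iff)
    show "(\<lambda>w i. if i \<in> S then w i else x i) \<in> (S \<rightarrow>\<^sub>E A) \<rightarrow> layer S x"
      using assms by (fastforce simp: in_layer_iff V_def PiE_def extensional_def)
    show "(\<lambda>i. if i \<in> S then restrict y S i else x i) = y" if "y \<in> layer S x" for y
    proof (rule V_eqI)
      show "(\<lambda>i. if i \<in> S then restrict y S i else x i) \<in> V"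
        using that assms by (fastforce simp: in_layer_iff V_def PiE_def extensional_def)
    qed (use that assms in \<open>auto simp: in_layer_iff\<close>)
    show "restrict (\<lambda>i. if i \<in> S then w i else x i) S = w" if "w \<in> S \<rightarrow>\<^sub>E A" for w
      using that by (auto simp: PiE_def extensional_def)
  qed
  from bij_betw_same_card[OF this] show ?thesis
    using finite_subset[OF assms(1) finite_I] by (simp add: card_PiE)
qed

text \<open>Every word of the layer is reached from \<open>x\<close> by rewriting the coordinates in
  \<open>S\<close> one at a time. Applied to all of \<open>I\<close>, this serves as connectedness
  of the Hamming graph.\<close>

lemma const_on_layer:
  assumes "S \<subseteq> I"
    and step: "\<And>x i a. x \<in> V \<Longrightarrow> i \<in> S \<Longrightarrow> a \<in> A \<Longrightarrow> g (x(i := a)) = g x"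
    and "x \<in> V" "y \<in> layer S x"
  shows "g y = g x"
proof -
  have "finite S"
    using assms(1) finite_I finite_subset by blast
  then show ?thesis
    using assms
  proof (induction S arbitrary: y)
    case empty
    then show ?case
      using V_eqI[of y x] by (auto simp: in_layer_iff)
  next
    case (insert i S)
    \<comment> \<open>Resetting coordinate \<open>i\<close> brings \<open>y\<close> into the smaller
      layer; restoring \<open>y i\<close> is one more rewriting step.\<close>
    define z where "z = y(i := x i)"
    have y: "y \<in> V" and i: "i \<in> I"
      using insert.prems by (auto simp: in_layer_iff)
    have zV: "z \<in> V"
      unfolding z_def using y i insert.prems by (intro upd_in_V V_nth_mem)
    have "z \<in> layer S x"
      using insert.prems zV by (auto simp: in_layer_iff z_def)
    then have "g z = g x"
      using insert.prems by (intro insert.IH) simp_all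
    moreover have "g (z(i := y i)) = g z"
      using zV V_nth_mem[OF y i] by (intro insert.prems(2)) simp_all
    ultimately show ?case
      by (simp add: z_def)
  qed
qed

lemma const_on_V:
  assumes "\<And>x i a. x \<in> V \<Longrightarrow> i \<in> I \<Longrightarrow> a \<in> A \<Longrightarrow> g (x(i := a)) = g x"
    and "x \<in> V" "y \<in> V"
  shows "g y = g x"
  using const_on_layer[of I g x y] assms by (auto simp: in_layer_iff)

text \<open>Each fibre is parametrised by the coordinates outside \<open>S\<close>.\<close>
lemma card_fibre_if_bij_on_layers:
  assumes S: "S \<subseteq> I"
    and bij: "\<And>z. z \<in> V \<Longrightarrow> bij_betw f (layer S z) L"
    and "y \<in> L"
  shows "card {x \<in> V. f x = y} = card A ^ (card I - card S)"
proof -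
  have "bij_betw (\<lambda>x. restrict x (I - S)) {x \<in> V. f x = y} ((I - S) \<rightarrow>\<^sub>E A)"
  proof (rule bij_betw_imageI)
    show "inj_on (\<lambda>x. restrict x (I - S)) {x \<in> V. f x = y}"
    proof (rule inj_onI)
      fix x x'
      assume "x \<in> {x \<in> V. f x = y}" "x' \<in> {x \<in> V. f x = y}"
        and r: "restrict x (I - S) = restrict x' (I - S)"
      then have x: "x \<in> V" "x' \<in> V" "f x = f x'"
        by auto
      from r have "\<forall>i\<in>I - S. x i = x' i"
        by (metis restrict_apply')
      then have "x' \<in> layer S x" "x \<in> layer S x"
        using x by (auto simp: in_layer_iff)
      then show "x = x'"
        using bij[OF x(1)] x(3) by (auto simp: bij_betw_def inj_on_def)
    qed
    show "(\<lambda>x. restrict x (I - S)) ` {x \<in> V. f x = y} = (I - S) \<rightarrow>\<^sub>E A" (is "?l = ?r")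
    proof
      show "?l \<subseteq> ?r"
        by (auto simp: V_nth_mem split: if_splits)
      show "?r \<subseteq> ?l"
      proof
        fix w assume w: "w \<in> (I - S) \<rightarrow>\<^sub>E A"
        show "w \<in> ?l"
        proof -
          obtain a where "a \<in> A" using A_nonempty by auto
          define z where "z = (\<lambda>i. if i \<in> I - S then w i else if i \<in> S then a else undefined)"
          have z: "z \<in> V"
            using w S \<open>a \<in> A\<close> by (auto simp: z_def V_def PiE_def extensional_def)
          then obtain x where x: "x \<in> layer S z" "f x = y"
            using bij[OF z] \<open>y \<in> L\<close> by (auto simp: bij_betw_def)
          then have "restrict x (I - S) = w"
            using w by (auto simp: in_layer_iff z_def PiE_def extensional_def)
          then show ?thesis
            using x layer_subset_V by blast
        qed
      qed
    qed
  qed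
  from bij_betw_same_card[OF this] show ?thesis
    using finite_I S by (simp add: card_PiE card_Diff_subset finite_subset)
qed

lemma image_if_bij_on_layers:
  assumes "\<And>z. z \<in> V \<Longrightarrow> bij_betw f (layer S z) L"
  shows "f ` V = L"
proof
  show "f ` V \<subseteq> L"
  proof (rule image_subsetI)
    fix x assume "x \<in> V"
    then have "x \<in> layer S x"
      by (simp add: in_layer_iff)
    with assms[OF \<open>x \<in> V\<close>] show "f x \<in> L"
      by (auto simp: bij_betw_def)
  qed
  obtain a where "a \<in> A"
    using A_nonempty by auto
  then have "(\<lambda>i\<in>I. a) \<in> V"
    by (auto simp: V_def)
  from assms[OF this] show "L \<subseteq> f ` V"
    using layer_subset_V by (auto simp: bij_betw_def)
qed

text \<open>For \<Gamma>, \<Delta> and the complement of \<Delta>, uniformity and rank come from a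
  set \<open>S\<close> whose parallel layers are all mapped bijectively onto one set.\<close>

lemma uniform_map_if_bij_on_layers:
  assumes "S \<subseteq> I" and "\<And>z. z \<in> V \<Longrightarrow> bij_betw f (layer S z) L"
  shows "uniform_map V f"
  using card_fibre_if_bij_on_layers[OF assms] image_if_bij_on_layers[OF assms(2)]
  by (auto simp: uniform_map_def kernel_classes_def)

lemma map_rank_if_bij_on_layers:
  assumes "S \<subseteq> I" and "\<And>z. z \<in> V \<Longrightarrow> bij_betw f (layer S z) L"
  shows "map_rank V f = card A ^ card S"
proof -
  obtain a where "a \<in> A"
    using A_nonempty by auto
  then have z: "(\<lambda>i\<in>I. a) \<in> V"
    by (auto simp: V_def)
  show ?thesis
    unfolding map_rank_def image_if_bij_on_layers[OF assms(2), simplified]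
    using bij_betw_same_card[OF assms(2)[OF z]] card_layer[OF assms(1) z] by simp
qed

end

section \<open>Endomorphisms of the Hamming graph\<close>

lemma ex_avoiding_two:
  assumes "card A \<ge> 3" shows "\<exists>a\<in>A. a \<noteq> b \<and> a \<noteq> c"
proof (rule ccontr)
  assume "\<not> ?thesis"
  then have "A \<subseteq> {b, c}" by blast
  then have "card A \<le> card {b, c}" by (intro card_mono) auto
  also have "\<dots> \<le> 2" by (simp add: card_insert_if)
  finally show False using assms by simp
qed

context words
begin

text \<open>For \<open>p \<noteq> q\<close>, \<open>y\<close> and \<open>z\<close> would differ at
  both positions. Hence triangles of the Hamming graph lie on a line.\<close>

lemma diffs_eq_if_singletons:
  assumes "diffs x y = {p}" "diffs x z = {q}" "diffs y z = {r}"
  shows "p = q"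
proof (rule ccontr)
  assume "p \<noteq> q"
  have "p \<in> I" "q \<in> I" "x p \<noteq> y p" "x q \<noteq> z q"
    using assms(1,2) by (simp_all add: diffs_eq_singleton_iff)
  moreover have "x q = y q" "x p = z p"
    using assms(1,2) \<open>p \<noteq> q\<close> \<open>p \<in> I\<close> \<open>q \<in> I\<close> by (simp_all add: diffs_eq_singleton_iff)
  ultimately have "{p, q} \<subseteq> diffs y z"
    by (auto simp: diffs_def)
  with assms(3) \<open>p \<noteq> q\<close> show False by simp
qed

end

locale hamming_endo = words +
  fixes f
  assumes f_V: "\<And>x. x \<in> V \<Longrightarrow> f x \<in> V"
    and f_adj: "\<And>x y i. \<lbrakk>x \<in> V; y \<in> V; diffs x y = {i}\<rbrakk> \<Longrightarrow> \<exists>p. diffs (f x) (f y) = {p}"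
    and card_A: "card A \<ge> 3"
begin

text \<open>The image of a line is a clique, and two of its edges with a common end close up to a
  triangle, so they have the same direction. Each edge is linked in this way to the one given by
  \<open>a0\<close> and \<open>a1\<close>.\<close>

lemma direction_exists:
  assumes "x \<in> V" "i \<in> I"
  shows "\<exists>p. \<forall>a\<in>A. \<forall>b\<in>A. a \<noteq> b \<longrightarrow> diffs (f (x(i := a))) (f (x(i := b))) = {p}"
proof -
  let ?D = "\<lambda>a b. diffs (f (x(i := a))) (f (x(i := b)))"
  have ex: "\<exists>p. ?D a b = {p}" if "a \<in> A" "b \<in> A" "a \<noteq> b" for a b
    using that assms by (intro f_adj[where i = i] upd_in_V) (simp_all add: diffs_upd)
  have turn: "?D a b = ?D a c" if abc: "a \<in> A" "b \<in> A" "c \<in> A" "a \<noteq> b" "a \<noteq> c" for a b c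
  proof (cases "b = c")
    case False
    then obtain p q r where pqr: "?D a b = {p}" "?D a c = {q}" "?D b c = {r}"
      using ex abc by meson
    from diffs_eq_if_singletons[OF this] show ?thesis
      using pqr by simp
  qed simp
  obtain a0 where a0: "a0 \<in> A"
    using A_nonempty by auto
  obtain a1 where a1: "a1 \<in> A" "a1 \<noteq> a0"
    using ex_avoiding_two[OF card_A, of a0 a0] by auto
  obtain p where p: "?D a0 a1 = {p}"
    using ex a0 a1 by metis
  have "?D a b = {p}" if "a \<in> A" "b \<in> A" "a \<noteq> b" for a b
  proof (cases "a = a0")
    case True
    then show ?thesis using turn[of a0 b a1] p that a0 a1 by auto
  next
    case False
    then have "?D a0 a = {p}"
      using turn[of a0 a a1] p that a0 a1 by auto
    then have "?D a a0 = {p}"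
      by (simp add: diffs_commute)
    then show ?thesis
      using turn[of a b a0] that a0 False by auto
  qed
  then show ?thesis by blast
qed

definition direction :: "('a \<Rightarrow> 'b) \<Rightarrow> 'a \<Rightarrow> 'a" where
  "direction x i =
     (SOME p. \<forall>a\<in>A. \<forall>b\<in>A. a \<noteq> b \<longrightarrow> diffs (f (x(i := a))) (f (x(i := b))) = {p})"

lemma direction:
  assumes "x \<in> V" "i \<in> I" "a \<in> A" "b \<in> A" "a \<noteq> b"
  shows "diffs (f (x(i := a))) (f (x(i := b))) = {direction x i}"
  using someI_ex[OF direction_exists[OF assms(1,2)]] assms(3-)
  unfolding direction_def by blast

text \<open>
  The images \<open>u\<close> and \<open>w\<close> of two neighbouring parallel lines are matched by edges.  If they had
  different directions \<open>p\<close> and \<open>q\<close>, then \<open>u\<close> and \<open>w\<close> would agree at \<open>p\<close> for at most one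
  parameter and at \<open>q\<close> for at most one parameter, so a third parameter would give two words
  differing at both \<open>p\<close> and \<open>q\<close>.
\<close>
lemma direction_upd:
  assumes x: "x \<in> V" and i: "i \<in> I" and j: "j \<in> I" and c: "c \<in> A"
  shows "direction (x(j := c)) i = direction x i"
\<comment> \<open>For \<open>i = j\<close> the definition of \<open>direction\<close> overwrites the
  changed coordinate anyway.\<close>
proof (cases "i = j \<or> c = x j")
  case True
  then show ?thesis
    by (auto simp: direction_def)
next
  case False
  then have ij: "i \<noteq> j" and cx: "c \<noteq> x j" by auto
  define u where "u = (\<lambda>a. f (x(i := a)))"
  define w where "w = (\<lambda>a. f (x(j := c, i := a)))"
  define p q where "p = direction x i" and "q = direction (x(j := c)) i"
  have u: "diffs (u a) (u b) = {p}" if "a \<in> A" "b \<in> A" "a \<noteq> b" for a b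
    using direction[OF x i that] by (simp add: u_def p_def)
  have w: "diffs (w a) (w b) = {q}" if "a \<in> A" "b \<in> A" "a \<noteq> b" for a b
    using direction[OF upd_in_V[OF x j c] i that] by (simp add: w_def q_def)
  have uw: "\<exists>r. diffs (u a) (w a) = {r}" if "a \<in> A" for a
    unfolding u_def w_def
  proof (rule f_adj[where i = j])
    show "diffs (x(i := a)) (x(j := c, i := a)) = {j}"
      using ij cx j by (auto simp: diffs_def)
  qed (use x i j c that in \<open>auto intro!: upd_in_V\<close>)
  show ?thesis
  proof (rule ccontr)
    assume "\<not> ?thesis"
    then have pq: "p \<noteq> q" by (simp add: p_def q_def)
    have unique_p: "a = b" if "a \<in> A" "b \<in> A" "u a p = w a p" "u b p = w b p" for a b
    proof (rule ccontr)
      assume "a \<noteq> b"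
      then have "u a p \<noteq> u b p" "w a p = w b p"
        using u[OF that(1,2)] w[OF that(1,2)] pq by (auto simp: diffs_eq_singleton_iff)
      with that show False by simp
    qed
    have unique_q: "a = b" if "a \<in> A" "b \<in> A" "u a q = w a q" "u b q = w b q" for a b
    proof (rule ccontr)
      assume "a \<noteq> b"
      then have "w a q \<noteq> w b q" "u a q = u b q"
        using u[OF that(1,2)] w[OF that(1,2)] pq by (auto simp: diffs_eq_singleton_iff)
      with that show False by simp
    qed
    \<comment> \<open>The only possible parameters at which the two lines agree in coordinate
      \<open>p\<close>, respectively \<open>q\<close>; if there is none, the chosen value is
      arbitrary and avoiding it does no harm.\<close>
    define ap aq where "ap = (SOME a. a \<in> A \<and> u a p = w a p)"
      and "aq = (SOME a. a \<in> A \<and> u a q = w a q)"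
    obtain a where a: "a \<in> A" "a \<noteq> ap" "a \<noteq> aq"
      using ex_avoiding_two[OF card_A] by blast
    have "u a p \<noteq> w a p"
      using unique_p[OF _ a(1)] a someI[of "\<lambda>a. a \<in> A \<and> u a p = w a p" a] by (auto simp: ap_def)
    moreover have "u a q \<noteq> w a q"
      using unique_q[OF _ a(1)] a someI[of "\<lambda>a. a \<in> A \<and> u a q = w a q" a] by (auto simp: aq_def)
    moreover obtain b where "b \<in> A" "b \<noteq> a"
      using ex_avoiding_two[OF card_A, of a a] by blast
    then have "p \<in> I" "q \<in> I"
      using u[OF a(1), of b] w[OF a(1), of b] by (auto simp: diffs_eq_singleton_iff)
    ultimately have "{p, q} \<subseteq> diffs (u a) (w a)"
      by (auto simp: diffs_def)
    with uw[OF a(1)] pq show False by auto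
  qed
qed

text \<open>Changing coordinate \<open>i\<close> moves the image only in coordinate
  \<open>\<phi> i\<close>, so all images stay in a layer with directions \<open>R\<close>. Within a
  layer over a set \<open>S\<close> of representatives of the fibres of \<open>\<phi>\<close>,
  coordinate \<open>\<phi> i\<close> of the image determines coordinate \<open>i\<close> of the
  argument; equal sizes then give surjectivity.\<close>

lemma bij_on_layers:
  "\<exists>S R z. S \<subseteq> I \<and> R \<subseteq> I \<and> card S = card R \<and> z \<in> V \<and> (I \<noteq> {} \<longrightarrow> R \<noteq> {}) \<and>
     (\<forall>x\<in>V. bij_betw f (layer S x) (layer R z))"
proof -
  obtain x0 where x0: "x0 \<in> V"
    using A_nonempty by (metis V_def PiE_eq_empty_iff all_not_in_conv)
  obtain a0 where a0: "a0 \<in> A"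
    using A_nonempty by auto
  obtain a1 where a1: "a1 \<in> A" "a1 \<noteq> a0"
    using ex_avoiding_two[OF card_A, of a0 a0] by auto
  define \<phi> where "\<phi> = direction x0"
  have dir: "diffs (f (x(i := a))) (f (x(i := b))) = {\<phi> i}"
    if "x \<in> V" "i \<in> I" "a \<in> A" "b \<in> A" "a \<noteq> b" for x i a b
  proof -
    have "direction x i = \<phi> i"
      unfolding \<phi>_def
      by (rule const_on_V[of "\<lambda>x. direction x i", OF direction_upd x0 that(1)])
        (assumption | rule that(2))+
    with direction[OF that] show ?thesis by simp
  qed
  define R where "R = \<phi> ` I"
  have "R \<subseteq> I"
    using dir[OF x0 _ a0 a1(1)] a1(2) by (auto simp: R_def diffs_eq_singleton_iff)
  define \<rho> where "\<rho> = inv_into I \<phi>"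
  define S where "S = \<rho> ` R"
  have S: "S \<subseteq> I"
    unfolding S_def R_def \<rho>_def by (auto intro: inv_into_into)
  have inj_S: "inj_on \<phi> S"
    unfolding S_def R_def \<rho>_def by (auto simp: inj_on_def f_inv_into_f)
  have "card S = card R"
    unfolding S_def R_def \<rho>_def by (intro card_image inj_on_inv_into) auto
  have local_step: "f (x(i := a)) p = f x p" if "x \<in> V" "i \<in> I" "p \<in> I" "\<phi> i \<noteq> p" "a \<in> A" for x i a p
    using dir[of x i a "x i"] that V_nth_mem by (cases "a = x i") (auto simp: diffs_eq_singleton_iff)
  have into: "f x \<in> layer R (f x0)" if "x \<in> V" for x
  proof -
    have "f x p = f x0 p" if p: "p \<in> I - R" for p
    proof (rule const_on_V[of "\<lambda>x. f x p", OF _ x0 \<open>x \<in> V\<close>])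
      fix y i a assume "y \<in> V" "i \<in> I" "a \<in> A"
      then show "f (y(i := a)) p = f y p"
        using p by (intro local_step) (auto simp: R_def)
    qed
    then show ?thesis
      using f_V that by (simp add: in_layer_iff)
  qed
  have inj: "inj_on f (layer S z)" if z: "z \<in> V" for z
  proof (rule inj_onI)
    fix x y assume x: "x \<in> layer S z" and y: "y \<in> layer S z" and eq: "f x = f y"
    have xV: "x \<in> V" and yV: "y \<in> V"
      using x y layer_subset_V by auto
    have agree: "y j = x j" if "j \<in> I - S" for j
      using x y that by (metis in_layer_iff)
    show "x = y"
    proof (rule V_eqI[OF xV yV])
      fix i assume i: "i \<in> I"
      show "x i = y i"
      proof (cases "i \<in> S")
        case False
        then show ?thesis using x y i by (metis DiffI in_layer_iff)
      next
        case True
        have yx: "y(i := x i) \<in> V"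
          using yV i V_nth_mem[OF xV i] by (rule upd_in_V)
        have "\<phi> i \<in> R" using i by (auto simp: R_def)
        \<comment> \<open>The other coordinates in \<open>S\<close> have directions different from
          \<open>\<phi> i\<close>, so passing between \<open>x\<close> and
          \<open>y(i := x i)\<close> leaves coordinate \<open>\<phi> i\<close> of the image
          alone.\<close>
        have "f x (\<phi> i) = f (y(i := x i)) (\<phi> i)"
        proof (rule const_on_layer[where S = "S - {i}" and g = "\<lambda>x. f x (\<phi> i)"])
          show "x \<in> layer (S - {i}) (y(i := x i))"
            using xV agree by (auto simp: in_layer_iff)
          show "f (w(j := a)) (\<phi> i) = f w (\<phi> i)" if "w \<in> V" "j \<in> S - {i}" "a \<in> A" for w j a
            using that S \<open>\<phi> i \<in> R\<close> \<open>R \<subseteq> I\<close> inj_S True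
            by (intro local_step) (auto simp: inj_on_def)
        qed (use S yx in auto)
        then have "f (y(i := y i)) (\<phi> i) = f (y(i := x i)) (\<phi> i)"
          using eq by simp
        then show ?thesis
          using dir[OF yV i V_nth_mem[OF yV i] V_nth_mem[OF xV i]] unfolding diffs_eq_singleton_iff by metis
      qed
    qed
  qed
  have "bij_betw f (layer S z) (layer R (f x0))" if z: "z \<in> V" for z
    unfolding bij_betw_def
  proof
    show "f ` layer S z = layer R (f x0)"
    proof (rule card_subset_eq[OF finite_layer])
      show "f ` layer S z \<subseteq> layer R (f x0)"
        using into layer_subset_V by blast
      show "card (f ` layer S z) = card (layer R (f x0))"
        using card_image[OF inj[OF z]] card_layer[OF S z] card_layer[OF \<open>R \<subseteq> I\<close> f_V[OF x0]]
          \<open>card S = card R\<close> by simp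
    qed
  qed (rule inj[OF z])
  moreover have "I \<noteq> {} \<longrightarrow> R \<noteq> {}"
    by (simp add: R_def)
  ultimately show ?thesis
    using S \<open>R \<subseteq> I\<close> \<open>card S = card R\<close> f_V[OF x0] by blast
qed

end

section \<open>Endomorphisms of the complement of the Hamming graph\<close>

context words
begin

lemma layer_eq_if_mem: "y \<in> layer S x \<Longrightarrow> layer S y = layer S x"
  unfolding in_layer_iff set_eq_iff by metis

lemma layer_sym: "x \<in> V \<Longrightarrow> y \<in> layer S x \<Longrightarrow> x \<in> layer S y"
  by (simp add: layer_def diffs_commute)

lemma layer_refl: "x \<in> V \<Longrightarrow> x \<in> layer S x"
  by (simp add: in_layer_iff)

lemma mem_singleton_layer_iff:
  assumes "x \<in> V" "y \<in> V"
  shows "y \<in> layer {i} x \<longleftrightarrow> x = y \<or> diffs x y = {i}"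
  using assms diffs_empty_iff[OF assms] by (auto simp: layer_def)

lemma ex_V: "\<exists>x. x \<in> V"
  using A_nonempty by (metis V_def PiE_eq_empty_iff all_not_in_conv)

lemma lines_eq_if_two_common:
  assumes "x \<in> V" "y \<in> V" "{a, b} \<subseteq> layer {i} x \<inter> layer {j} y" "a \<noteq> b"
  shows "layer {i} x = layer {j} y"
proof -
  have ab: "a \<in> layer {i} x" "b \<in> layer {i} x" "a \<in> layer {j} y" "b \<in> layer {j} y"
    using assms(3) by auto
  then have V: "a \<in> V" "b \<in> V"
    using layer_subset_V by auto
  have "b \<in> layer {i} a" "b \<in> layer {j} a"
    using layer_eq_if_mem ab by blast+
  with V \<open>a \<noteq> b\<close> have "i = j"
    by (simp add: mem_singleton_layer_iff)
  then show ?thesis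
    using ab layer_eq_if_mem by metis
qed

lemma pairwise_close_subset_line:
  assumes "C \<subseteq> V" "I \<noteq> {}"
    and close: "\<And>x y. \<lbrakk>x \<in> C; y \<in> C; x \<noteq> y\<rbrakk> \<Longrightarrow> \<exists>i. diffs x y = {i}"
  shows "\<exists>i\<in>I. \<exists>x\<in>V. C \<subseteq> layer {i} x"
proof (cases "\<exists>x\<in>C. \<exists>y\<in>C. x \<noteq> y")
  case True
  then obtain x y where xy: "x \<in> C" "y \<in> C" "x \<noteq> y"
    by auto
  then obtain i where i: "diffs x y = {i}"
    using close by blast
  have "z \<in> layer {i} x" if zC: "z \<in> C" for z
  proof (cases "z = x \<or> z = y")
    case True
    then show ?thesis
      using i subsetD[OF assms(1) xy(1)] subsetD[OF assms(1) xy(2)]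
      by (elim disjE) (simp_all add: mem_singleton_layer_iff)
  next
    case False
    then obtain j k where jk: "diffs x z = {j}" "diffs y z = {k}"
      using close[OF xy(1) zC] close[OF xy(2) zC] by blast
    have "i = j"
      by (rule diffs_eq_if_singletons[OF i jk])
    then show ?thesis
      using jk(1) subsetD[OF assms(1) xy(1)] subsetD[OF assms(1) zC]
      by (simp add: mem_singleton_layer_iff)
  qed
  moreover have "i \<in> I"
    using i by (auto simp: diffs_def)
  ultimately show ?thesis
    using xy assms(1) by blast
next
  case False
  obtain i where "i \<in> I"
    using assms(2) by auto
  moreover obtain x where "x \<in> V" "C \<subseteq> {x}"
  proof (cases "C = {}")
    case True
    then show ?thesis using ex_V that by auto
  next
    case False
    with \<open>\<not> (\<exists>x\<in>C. \<exists>y\<in>C. x \<noteq> y)\<close> show ?thesis using that assms(1) by blast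
  qed
  ultimately show ?thesis
    using layer_refl[of x "{i}"] by auto
qed

end

locale far_endo = words +
  fixes f
  assumes f_V: "\<And>x. x \<in> V \<Longrightarrow> f x \<in> V"
    and f_adj: "\<And>x y. \<lbrakk>x \<in> V; y \<in> V; card (diffs x y) \<ge> 2\<rbrakk> \<Longrightarrow> card (diffs (f x) (f y)) \<ge> 2"
    and card_I: "card I \<ge> 2"
begin

definition preimage :: "('a \<Rightarrow> 'b) set \<Rightarrow> ('a \<Rightarrow> 'b) set" where
  "preimage L = {x \<in> V. f x \<in> L}"

lemma finite_preimage: "finite (preimage L)"
  unfolding preimage_def using finite_V by simp

text \<open>Read backwards, \<open>f_adj\<close> says that words with images at distance at most 1
  are themselves at distance at most 1, so the preimage of a line is pairwise close.\<close>

lemma preimage_line_subset_line: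
  assumes "v \<in> V" "i \<in> I"
  shows "\<exists>j\<in>I. \<exists>x\<in>V. preimage (layer {i} v) \<subseteq> layer {j} x"
proof (rule pairwise_close_subset_line)
  fix x y
  assume "x \<in> preimage (layer {i} v)" "y \<in> preimage (layer {i} v)" and "x \<noteq> y"
  then have xy: "x \<in> V" "y \<in> V" "f x \<in> layer {i} v" "f y \<in> layer {i} v"
    by (auto simp: preimage_def)
  then have "diffs (f x) (f y) \<subseteq> {i}"
    by (auto simp: in_layer_iff diffs_def)
  then have "card (diffs (f x) (f y)) \<le> 1"
    using card_mono[of "{i}"] by force
  then have "card (diffs x y) < 2"
    using f_adj[OF xy(1,2)] by linarith
  moreover have "card (diffs x y) \<noteq> 0"
    using \<open>x \<noteq> y\<close> xy diffs_empty_iff finite_I by (simp add: diffs_def)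
  ultimately have "card (diffs x y) = 1"
    by linarith
  then show "\<exists>i. diffs x y = {i}"
    by (simp add: card_1_singleton_iff)
qed (use assms in \<open>auto simp: preimage_def\<close>)

lemma card_preimage_line_le:
  assumes "v \<in> V" "i \<in> I"
  shows "card (preimage (layer {i} v)) \<le> card A"
proof -
  obtain j x where "j \<in> I" "x \<in> V" "preimage (layer {i} v) \<subseteq> layer {j} x"
    using preimage_line_subset_line[OF assms] by blast
  then show ?thesis
    using card_mono[OF finite_layer, of _ "{j}" x] card_layer[of "{j}" x] by simp
qed

text \<open>
  The lines in direction \<open>i\<close> partition the space, so on average a preimage has \<open>card A\<close>
  elements, and no preimage exceeds this.
\<close>
lemma card_preimage_line:
  assumes v: "v \<in> V" and i: "i \<in> I"
  shows "card (preimage (layer {i} v)) = card A"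
proof -
  \<comment> \<open>Double counting of the pairs of \<open>w\<close> and \<open>x\<close> with
    \<open>f x\<close> on the line through \<open>w\<close>; each line is counted once for each of
    its \<open>card A\<close> points.\<close>
  have "(\<Sum>w\<in>V. card (preimage (layer {i} w)))
      = (\<Sum>w\<in>V. \<Sum>x\<in>V. of_bool (f x \<in> layer {i} w))"
    using finite_V by (intro sum.cong refl) (simp add: preimage_def sum_of_bool_eq Int_def)
  also have "\<dots> = (\<Sum>x\<in>V. \<Sum>w\<in>V. of_bool (f x \<in> layer {i} w))"
    by (rule sum.swap)
  also have "\<dots> = (\<Sum>x\<in>V. card A)"
  proof (rule sum.cong)
    fix x assume "x \<in> V"
    then have "{w \<in> V. f x \<in> layer {i} w} = layer {i} (f x)"
      using f_V layer_subset_V layer_sym by blast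
    then show "(\<Sum>w\<in>V. of_bool (f x \<in> layer {i} w)) = card A"
      using finite_V i f_V \<open>x \<in> V\<close> by (simp add: sum_of_bool_eq Int_def card_layer)
  qed simp
  finally have eq: "(\<Sum>w\<in>V. card (preimage (layer {i} w))) = (\<Sum>w\<in>V. card A)" .
  show ?thesis
  proof (rule ccontr)
    assume "\<not> ?thesis"
    then have "card (preimage (layer {i} v)) < card A"
      using card_preimage_line_le[OF v i] by simp
    then have "(\<Sum>w\<in>V. card (preimage (layer {i} w))) < (\<Sum>w\<in>V. card A)"
      using card_preimage_line_le i v by (intro sum_strict_mono_ex1 finite_V) auto
    with eq show False by simp
  qed
qed

lemma preimage_line_is_line:
  assumes "v \<in> V" "i \<in> I"
  shows "\<exists>j\<in>I. \<exists>x\<in>V. preimage (layer {i} v) = layer {j} x"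
proof -
  obtain j x where jx: "j \<in> I" "x \<in> V" "preimage (layer {i} v) \<subseteq> layer {j} x"
    using preimage_line_subset_line[OF assms] by blast
  have "preimage (layer {i} v) = layer {j} x"
    using card_preimage_line[OF assms] jx card_layer[of "{j}" x]
    by (intro card_subset_eq finite_layer) auto
  with jx show ?thesis by blast
qed

text \<open>
  Two lines through a vertex with at least two preimages have preimages that are lines sharing
  two points, hence equal.
\<close>
lemma neighbour_of_multiple_fibre_empty:
  assumes v: "v \<in> V" and w: "w \<in> V" and vw: "diffs v w = {i}"
    and ab: "a \<in> preimage {v}" "b \<in> preimage {v}" "a \<noteq> b"
  shows "preimage {w} = {}"
proof -
  have i: "i \<in> I"
    using vw by (auto simp: diffs_def)
  have "\<not> I \<subseteq> {i}"
    using card_I card_mono[of "{i}" I] by auto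
  then obtain j where j: "j \<in> I" "j \<noteq> i"
    by auto
  obtain i' x where x: "x \<in> V" "preimage (layer {i} v) = layer {i'} x"
    using preimage_line_is_line[OF v i] by blast
  obtain j' y where y: "y \<in> V" "preimage (layer {j} v) = layer {j'} y"
    using preimage_line_is_line[OF v j(1)] by blast
  have mono: "preimage {v} \<subseteq> preimage (layer {k} v)" for k
    using layer_refl[OF v] by (auto simp: preimage_def)
  have "layer {i'} x = layer {j'} y"
    using lines_eq_if_two_common[OF x(1) y(1)] ab mono[of i] mono[of j] x y by blast
  then have "preimage {w} \<subseteq> preimage (layer {j} v)"
    using x y w vw v by (auto simp: preimage_def mem_singleton_layer_iff)
  moreover have "w \<notin> layer {j} v"
    using vw v w j by (auto simp: mem_singleton_layer_iff diffs_def)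
  ultimately show ?thesis
    by (auto simp: preimage_def)
qed

text \<open>All other points of a line through \<open>v\<close> have empty fibre, so the
  \<open>card A\<close> words in the preimage of that line all lie over \<open>v\<close>.\<close>

lemma multiple_fibre_card:
  assumes v: "v \<in> V" and ab: "a \<in> preimage {v}" "b \<in> preimage {v}" "a \<noteq> b"
  shows "card (preimage {v}) = card A"
proof -
  obtain i where i: "i \<in> I"
    using card_I by (metis all_not_in_conv card.empty not_numeral_le_zero)
  have "preimage (layer {i} v) \<subseteq> preimage {v}"
  proof
    fix x assume x: "x \<in> preimage (layer {i} v)"
    then have xV: "f x \<in> V" "f x \<in> layer {i} v" "x \<in> preimage {f x}"
      using f_V by (auto simp: preimage_def)
    then have "\<not> diffs v (f x) = {i}"
      using neighbour_of_multiple_fibre_empty[OF v _ _ ab] by blast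
    then show "x \<in> preimage {v}"
      using xV v x by (auto simp: mem_singleton_layer_iff preimage_def)
  qed
  moreover have "preimage {v} \<subseteq> preimage (layer {i} v)"
    using layer_refl[OF v] by (auto simp: preimage_def)
  ultimately show ?thesis
    using card_preimage_line[OF v i] by auto
qed

text \<open>
  The \<open>card A\<close> preimages of a line through \<open>w\<close> land on its at most \<open>card A - 1\<close> points other
  than \<open>w\<close>, so one of these points has a second preimage.
\<close>
lemma neighbour_of_empty_fibre:
  assumes w: "w \<in> V" and u: "u \<in> V" and wu: "diffs w u = {i}"
    and empty: "preimage {w} = {}" and x: "x \<in> preimage {u}"
  shows "card (preimage {u}) = card A"
proof -
  have i: "i \<in> I"
    using wu by (auto simp: diffs_def)
  let ?P = "preimage (layer {i} w)"
  have "f ` ?P \<subseteq> layer {i} w - {w}"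
    using empty by (auto simp: preimage_def)
  then have "card (f ` ?P) \<le> card (layer {i} w - {w})"
    by (intro card_mono finite_Diff finite_layer)
  also have "\<dots> < card (layer {i} w)"
    using layer_refl[OF w] by (intro psubset_card_mono finite_layer) auto
  also have "\<dots> = card ?P"
    using card_preimage_line[OF w i] card_layer[of "{i}" w] i w by simp
  finally have "\<not> inj_on f ?P"
    using card_image by fastforce
  then obtain a b where ab: "a \<in> ?P" "b \<in> ?P" "a \<noteq> b" "f a = f b"
    by (auto simp: inj_on_def)
  define v where "v = f a"
  have v: "v \<in> layer {i} w" "v \<in> V" "a \<in> preimage {v}" "b \<in> preimage {v}"
    using ab f_V by (auto simp: v_def preimage_def)
  have "u \<in> layer {i} w"
    using wu w u by (simp add: mem_singleton_layer_iff)
  then have "u \<in> layer {i} v"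
    using v layer_eq_if_mem by blast
  then have "u = v \<or> diffs v u = {i}"
    using v u by (auto simp: mem_singleton_layer_iff)
  \<comment> \<open>Otherwise \<open>u\<close> would be a neighbour of \<open>v\<close> on the line
    and have empty fibre, contrary to \<open>x\<close>.\<close>
  then have "u = v"
    using neighbour_of_multiple_fibre_empty[OF v(2) u _ v(3,4) ab(3)] x by blast
  with multiple_fibre_card[OF v(2-4) ab(3)] show ?thesis by simp
qed

end

section \<open>Fibres of a non-injective endomorphism\<close>

locale far_singular_endo = far_endo +
  assumes not_inj: "\<not> inj_on f V"
begin

text \<open>Having a fibre that is not a singleton passes between neighbours: beside an empty fibre,
  a nonempty one has \<open>card A \<ge> 2\<close> elements, and beside a multiple fibre all are
  empty. A value taken twice starts the propagation.\<close>

lemma fibre_not_singleton: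
  assumes "v \<in> V" "preimage {v} \<noteq> {}"
  shows "\<exists>a\<in>preimage {v}. \<exists>b\<in>preimage {v}. a \<noteq> b"
proof -
  define P where "P v \<longleftrightarrow> preimage {v} = {} \<or> (\<exists>a\<in>preimage {v}. \<exists>b\<in>preimage {v}. a \<noteq> b)" for v
  obtain a b where ab: "a \<in> V" "b \<in> V" "a \<noteq> b" "f a = f b"
    using not_inj by (auto simp: inj_on_def)
  then have P0: "P (f a)"
    by (auto simp: P_def preimage_def)
  have card_A: "card A \<ge> 2"
  proof -
    have "\<not> card V \<le> Suc 0"
      using ab(1-3) by (auto simp: card_le_Suc0_iff_eq[OF finite_V])
    then have "card A \<noteq> 1" "card A \<noteq> 0"
      using A_nonempty finite_A by (auto simp: card_V)
    then show ?thesis by linarith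
  qed
  have step: "P w" if w: "w \<in> V" and u: "u \<in> V" and wu: "diffs w u = {i}" and "P u" for w u i
  proof (cases "preimage {u} = {}")
    case True
    show ?thesis
    proof (cases "preimage {w} = {}")
      case False
      then have "card (preimage {w}) = card A"
        using neighbour_of_empty_fibre[OF u w _ True] wu diffs_commute by fastforce
      then have "\<not> card (preimage {w}) \<le> Suc 0"
        using card_A by simp
      then show ?thesis
        using card_le_Suc0_iff_eq[OF finite_preimage] by (auto simp: P_def)
    qed (simp add: P_def)
  next
    case False
    with \<open>P u\<close> obtain a b where "a \<in> preimage {u}" "b \<in> preimage {u}" "a \<noteq> b"
      by (auto simp: P_def)
    from neighbour_of_multiple_fibre_empty[OF u w _ this] wu show ?thesis
      by (simp add: P_def diffs_commute)
  qed
  have "P v = P (f a)"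
  proof (rule const_on_V[OF _ f_V[OF ab(1)] assms(1)])
    fix x i c assume *: "x \<in> V" "i \<in> I" "c \<in> A"
    then have **: "x(i := c) \<in> V" by (rule upd_in_V)
    show "P (x(i := c)) = P x"
    proof (cases "x i = c")
      case False
      then have "diffs x (x(i := c)) = {i}"
        using * by (auto simp: diffs_def)
      then show ?thesis
        using step[OF *(1) **, of i] step[OF ** *(1), of i] by (auto simp: diffs_commute)
    qed (simp add: fun_upd_idem)
  qed
  with P0 assms(2) show ?thesis by (simp add: P_def)
qed

lemma uniform: "uniform_map V f"
proof -
  have "card {x \<in> V. f x = y} = card A" if "y \<in> f ` V" for y
  proof -
    have "y \<in> V" "preimage {y} \<noteq> {}"
      using that f_V by (auto simp: preimage_def)
    from multiple_fibre_card[OF this(1)] fibre_not_singleton[OF this] show ?thesis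
      by (auto simp: preimage_def)
  qed
  then show ?thesis
    by (auto simp: uniform_map_def kernel_classes_def)
qed

lemma image_far:
  assumes "u \<in> f ` V" "v \<in> f ` V" "u \<noteq> v"
  shows "card (diffs u v) \<ge> 2"
proof (rule ccontr)
  assume "\<not> ?thesis"
  moreover have uv: "u \<in> V" "v \<in> V" "preimage {u} \<noteq> {}" "preimage {v} \<noteq> {}"
    using assms f_V by (auto simp: preimage_def)
  have "card (diffs u v) \<noteq> 0"
    using assms(3) uv diffs_empty_iff finite_I by (simp add: diffs_def)
  ultimately have "card (diffs u v) = 1"
    by linarith
  then obtain i where "diffs u v = {i}"
    by (auto simp: card_1_singleton_iff)
  then show False
    using fibre_not_singleton[OF uv(1,3)] neighbour_of_multiple_fibre_empty[OF uv(1,2)] uv(4) by blast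
qed

lemma rank: "map_rank V f = card A ^ (card I - 1)"
proof -
  have "card A ^ card I = card V"
    by (simp add: card_V)
  also have "\<dots> = (\<Sum>y\<in>f ` V. card (preimage {y}))"
    using sum.image_gen[OF finite_V, of "\<lambda>_. 1::nat" f] by (simp add: preimage_def)
  also have "\<dots> = (\<Sum>y\<in>f ` V. card A)"
  proof (rule sum.cong)
    fix y assume "y \<in> f ` V"
    then have "y \<in> V" "preimage {y} \<noteq> {}"
      using f_V by (auto simp: preimage_def)
    from multiple_fibre_card[OF this(1)] fibre_not_singleton[OF this] show "card (preimage {y}) = card A"
      by blast
  qed simp
  also have "\<dots> = card (f ` V) * card A"
    by simp
  finally have "card A ^ card I = map_rank V f * card A"
    by (simp add: map_rank_def)
  moreover have "card I = Suc (card I - 1)"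
    using card_I by simp
  then have "card A ^ card I = card A ^ (card I - 1) * card A"
    by (metis power_Suc2)
  moreover have "card A > 0"
    using A_nonempty finite_A by (simp add: card_gt_0_iff)
  ultimately show ?thesis
    by simp
qed

end

section \<open>Endomorphisms of the opposite graph\<close>

lemma ex_bij_betw_two_points:
  assumes "p \<in> A" "q \<in> A" "p \<noteq> q" "x \<in> A" "y \<in> A" "x \<noteq> y"
  shows "\<exists>\<pi>. bij_betw \<pi> A A \<and> \<pi> p = x \<and> \<pi> q = y"
proof -
  \<comment> \<open>\<open>q'\<close> is where \<open>q\<close> lands once \<open>p\<close> has been
    moved to \<open>x\<close>; the second transposition moves it to \<open>y\<close> and fixes
    \<open>x\<close>.\<close>
  define q' where "q' = transpose p x q"
  have q': "q' \<in> A" "q' \<noteq> x"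
    using assms by (auto simp: q'_def transpose_def)
  have "bij_betw (transpose q' y \<circ> transpose p x) A A"
    using assms q' by (intro bij_betw_trans[where B = A]) simp_all
  moreover have "(transpose q' y \<circ> transpose p x) p = x"
    using assms q' by simp
  moreover have "(transpose q' y \<circ> transpose p x) q = y"
    by (simp add: q'_def)
  ultimately show ?thesis by blast
qed

section \<open>Transversals and exact sets\<close>

context words
begin

text \<open>For nonempty \<open>I\<close>, a clique of \<Delta> with \<open>card A\<close> members,
  listed by the letters.\<close>

definition transversal :: "('a \<Rightarrow> 'i \<Rightarrow> 'a) \<Rightarrow> bool" where
  "transversal \<tau> \<longleftrightarrow> (\<forall>t\<in>A. \<tau> t \<in> V) \<and> (\<forall>i\<in>I. bij_betw (\<lambda>t. \<tau> t i) A A)"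

definition exact :: "('i \<Rightarrow> 'a) set \<Rightarrow> bool" where
  "exact F \<longleftrightarrow> (\<forall>\<tau>. transversal \<tau> \<longrightarrow> card {t \<in> A. \<tau> t \<in> F} = 1)"

lemma transversal_diffs:
  "transversal \<tau> \<Longrightarrow> s \<in> A \<Longrightarrow> t \<in> A \<Longrightarrow> s \<noteq> t \<Longrightarrow> diffs (\<tau> s) (\<tau> t) = I"
  unfolding transversal_def diffs_def bij_betw_def inj_on_def by blast

text \<open>Complete \<open>x\<close> and \<open>y\<close> to a transversal. Exchanging their
  letters at \<open>i\<close> gives a second transversal with the same remaining members, and
  \<open>F\<close> meets both exactly once.\<close>

lemma exact_swap:
  assumes F: "exact F" and x: "x \<in> V" and y: "y \<in> V" and xy: "diffs x y = I"
    and i: "i \<in> I" and A: "card A \<ge> 3"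
  shows "of_bool (x \<in> F) + of_bool (y \<in> F)
       = (of_bool (x(i := y i) \<in> F) + of_bool (y(i := x i) \<in> F) :: int)"
proof -
  obtain p where p: "p \<in> A"
    using A_nonempty by auto
  obtain q where q: "q \<in> A" "q \<noteq> p"
    using ex_avoiding_two[OF A, of p p] by auto
  have "\<exists>\<pi>. bij_betw \<pi> A A \<and> \<pi> p = x j \<and> \<pi> q = y j" if "j \<in> I" for j
    using that x y xy p q by (intro ex_bij_betw_two_points) (auto simp: V_nth_mem diffs_def)
  then obtain \<pi> where
    \<pi>: "\<And>j. j \<in> I \<Longrightarrow> bij_betw (\<pi> j) A A \<and> \<pi> j p = x j \<and> \<pi> j q = y j"
    by metis
  define \<tau> where "\<tau> t = (\<lambda>j\<in>I. \<pi> j t)" for t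
  define \<tau>' where "\<tau>' t = (\<tau> t)(i := \<pi> i (transpose p q t))" for t
  have \<pi>A: "\<pi> j t \<in> A" if "j \<in> I" "t \<in> A" for j t
    using \<pi>[OF that(1)] that(2) by (auto simp: bij_betw_def)
  have trA: "transpose p q t \<in> A" if "t \<in> A" for t
    using that p q by (auto simp: transpose_def)
  have \<tau>V: "\<tau> t \<in> V" if "t \<in> A" for t
    using \<pi>A that by (auto simp: \<tau>_def V_def)
  have T: "transversal \<tau>"
    using \<tau>V \<pi> by (auto simp: transversal_def \<tau>_def)
  have "bij_betw (\<lambda>t. \<tau>' t j) A A" if "j \<in> I" for j
  proof (cases "j = i")
    case True
    have "bij_betw (\<pi> i \<circ> transpose p q) A A"
      using \<pi>[OF i] p q by (intro bij_betw_trans[where B = A]) simp_all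
    then show ?thesis
      using True by (simp add: \<tau>'_def comp_def)
  next
    case False
    then show ?thesis
      using \<pi> that by (simp add: \<tau>'_def \<tau>_def)
  qed
  then have T': "transversal \<tau>'"
    using \<tau>V \<pi>A trA i by (auto simp: transversal_def \<tau>'_def intro!: upd_in_V)
  have split: "int (card {t \<in> A. \<sigma> t \<in> F})
      = of_bool (\<sigma> p \<in> F) + of_bool (\<sigma> q \<in> F) + (\<Sum>t\<in>A - {p} - {q}. of_bool (\<sigma> t \<in> F))"
    for \<sigma> :: "'a \<Rightarrow> 'i \<Rightarrow> 'a"
  proof -
    have "int (card {t \<in> A. \<sigma> t \<in> F}) = (\<Sum>t\<in>A. of_bool (\<sigma> t \<in> F))"
      using finite_A by (simp add: Int_def)
    also have "\<dots> = of_bool (\<sigma> p \<in> F) + (\<Sum>t\<in>A - {p}. of_bool (\<sigma> t \<in> F))"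
      by (rule sum.remove[OF finite_A p])
    also have "(\<Sum>t\<in>A - {p}. of_bool (\<sigma> t \<in> F))
        = of_bool (\<sigma> q \<in> F) + (\<Sum>t\<in>A - {p} - {q}. of_bool (\<sigma> t \<in> F))"
      using q finite_A by (intro sum.remove) auto
    finally show ?thesis by simp
  qed
  have "\<tau> p = x" "\<tau> q = y"
    using \<tau>V[OF p] \<tau>V[OF q(1)] x y \<pi> by (auto intro!: V_eqI simp: \<tau>_def)
  moreover from this have "\<tau>' p = x(i := y i)" "\<tau>' q = y(i := x i)"
    using \<pi>[OF i] by (simp_all add: \<tau>'_def)
  moreover have "(\<Sum>t\<in>A - {p} - {q}. of_bool (\<tau>' t \<in> F)) = (\<Sum>t\<in>A - {p} - {q}. of_bool (\<tau> t \<in> F) :: int)"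
    using i by (intro sum.cong refl) (simp add: \<tau>'_def \<tau>_def fun_upd_idem)
  moreover have "card {t \<in> A. \<tau> t \<in> F} = card {t \<in> A. \<tau>' t \<in> F}"
    using F T T' by (simp add: exact_def)
  ultimately show ?thesis
    using split[of \<tau>] split[of \<tau>'] by simp
qed

text \<open>
  The swap identity makes the effect on membership of changing coordinate \<open>i\<close> the same at any two
  words that differ at all other coordinates; with three letters, a common such word exists for
  any two words, so the effect does not depend on the other coordinates at all.
\<close>
lemma exact_difference:
  assumes F: "exact F" and x: "x \<in> V" and y: "y \<in> V"
    and i: "i \<in> I" and a: "a \<in> A" and b: "b \<in> A" and A: "card A \<ge> 3"
  shows "of_bool (x(i := a) \<in> F) - of_bool (x(i := b) \<in> F)
       = (of_bool (y(i := a) \<in> F) - of_bool (y(i := b) \<in> F) :: int)"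
proof (cases "a = b")
  case False
  have *: "of_bool (u(i := a) \<in> F) - of_bool (u(i := b) \<in> F)
       = (of_bool (w(i := a) \<in> F) - of_bool (w(i := b) \<in> F) :: int)"
    if "u \<in> V" "w \<in> V" "\<And>j. j \<in> I \<Longrightarrow> u j \<noteq> w j" for u w
  proof -
    have "diffs (u(i := a)) (w(i := b)) = I"
      using that False by (auto simp: diffs_def)
    from exact_swap[OF F upd_in_V[OF that(1) i a] upd_in_V[OF that(2) i b] this i A]
    show ?thesis by simp
  qed
  have "\<forall>j\<in>I. \<exists>c\<in>A. c \<noteq> x j \<and> c \<noteq> y j"
    using ex_avoiding_two[OF A] by blast
  then obtain z where z: "\<And>j. j \<in> I \<Longrightarrow> z j \<in> A \<and> z j \<noteq> x j \<and> z j \<noteq> y j"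
    by metis
  have "restrict z I \<in> V"
    using z by (auto simp: V_def)
  moreover have z': "x j \<noteq> z j" "y j \<noteq> z j" if "j \<in> I" for j
    using z[OF that] by metis+
  ultimately have "of_bool (u(i := a) \<in> F) - of_bool (u(i := b) \<in> F)
       = (of_bool ((restrict z I)(i := a) \<in> F) - of_bool ((restrict z I)(i := b) \<in> F) :: int)"
    if "u \<in> {x, y}" for u
    using that x y z' by (intro *) auto
  from this[of x] this[of y] show ?thesis
    by simp
qed simp

text \<open>Membership varies among the constant words, which form a transversal, so some coordinate
  \<open>i\<close> influences it. By \<open>exact_difference\<close> this influence is the same at
  all words, so one letter \<open>e\<close> at \<open>i\<close> always forces membership. Then no
  other coordinate matters, since its influence may be measured where the letter at \<open>i\<close>
  is \<open>e\<close>.\<close>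

lemma exact_dictator:
  assumes F: "exact F" "F \<subseteq> V" and A: "card A \<ge> 3" and "I \<noteq> {}"
  shows "\<exists>i\<in>I. \<exists>a\<in>A. F = {x \<in> V. x i = a}"
proof -
  define k where "k t = (\<lambda>i\<in>I. t)" for t :: 'a
  have kV: "k t \<in> V" if "t \<in> A" for t
    using that by (auto simp: k_def V_def)
  then have "transversal k"
    by (auto simp: transversal_def k_def bij_betw_def inj_on_def)
  then have "card {t \<in> A. k t \<in> F} = 1"
    using F(1) by (simp add: exact_def)
  then obtain a where a: "{t \<in> A. k t \<in> F} = {a}"
    by (auto simp: card_1_singleton_iff)
  then have ka: "k t \<in> F \<longleftrightarrow> t = a" if "t \<in> A" for t
    using that by auto
  have aA: "a \<in> A" using a by auto
  obtain a' where "a' \<in> A" "a' \<noteq> a"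
    using ex_avoiding_two[OF A, of a a] by auto
  then have "(k a \<in> F) \<noteq> (k a' \<in> F)"
    using ka aA by blast
  then have "\<not> (\<forall>x i c. x \<in> V \<longrightarrow> i \<in> I \<longrightarrow> c \<in> A \<longrightarrow> (x(i := c) \<in> F) = (x \<in> F))"
    using const_on_V[of "\<lambda>x. x \<in> F" "k a" "k a'"] kV[OF aA] kV[OF \<open>a' \<in> A\<close>] by metis
  then obtain x i c where x: "x \<in> V" and i: "i \<in> I" and c: "c \<in> A"
    and "(x(i := c) \<in> F) \<noteq> (x \<in> F)"
    by blast
  then obtain d where d: "d \<in> A" "(x(i := c) \<in> F) \<noteq> (x(i := d) \<in> F)"
    using V_nth_mem[OF x i] fun_upd_triv by metis
  then obtain e e' where e: "e \<in> A" "e' \<in> A" "x(i := e) \<in> F" "x(i := e') \<notin> F"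
    using c by metis
  \<comment> \<open>A difference of indicators equal to 1 determines both of them.\<close>
  have top: "y(i := e) \<in> F" if "y \<in> V" for y
    using exact_difference[OF F(1) x that i e(1,2) A] e(3,4)
    by (auto simp: of_bool_def split: if_splits)
  have other: "(y(j := c) \<in> F) = (y \<in> F)" if y: "y \<in> V" and j: "j \<in> I - {i}" and c: "c \<in> A" for y j c
  proof -
    have ji: "j \<in> I" "j \<noteq> i" using j by auto
    have "y(i := e, j := b) \<in> F" if "b \<in> A" for b
      using top[OF upd_in_V[OF y ji(1) that]] fun_upd_twist[OF ji(2), of y] by metis
    from this[OF c] this[OF V_nth_mem[OF y ji(1)]] show ?thesis
      using exact_difference[OF F(1) upd_in_V[OF y i e(1)] y ji(1) c V_nth_mem[OF y ji(1)] A]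
      by (auto simp: of_bool_def split: if_splits)
  qed
  have "y \<in> F \<longleftrightarrow> y i = a" if y: "y \<in> V" for y
  proof -
    have yA: "y i \<in> A" using y i by (rule V_nth_mem)
    have "(y \<in> F) = (k (y i) \<in> F)"
    proof (rule const_on_layer[of "I - {i}" "\<lambda>x. x \<in> F"])
      show "y \<in> layer (I - {i}) (k (y i))"
        using y i by (auto simp: in_layer_iff k_def)
    qed (use other kV[OF yA] in auto)
    then show ?thesis
      using ka[OF yA] by simp
  qed
  then have "F = {y \<in> V. y i = a}"
    using F(2) by auto
  with i aA show ?thesis by blast
qed

section \<open>Proper colourings and endomorphisms of \<Delta>\<close>

lemma ex_word_two_coordinates:
  assumes "i \<in> I" "j \<in> I" "i \<noteq> j" "a \<in> A" "b \<in> A"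
  shows "\<exists>x\<in>V. x i = a \<and> x j = b"
proof -
  obtain z where "z \<in> V" using ex_V by auto
  then have "z(i := a, j := b) \<in> V"
    using assms by (intro upd_in_V)
  then show ?thesis
    using assms by (intro bexI[of _ "z(i := a, j := b)"]) auto
qed

text \<open>A transversal is a clique with as many members as there are colours, so each colour
  occurs exactly once on it.\<close>

lemma colour_class_exact:
  assumes c: "\<And>x. x \<in> V \<Longrightarrow> c x \<in> A"
    and proper: "\<And>x y. \<lbrakk>x \<in> V; y \<in> V; diffs x y = I\<rbrakk> \<Longrightarrow> c x \<noteq> c y"
    and s: "s \<in> A"
  shows "exact {x \<in> V. c x = s}"
  unfolding exact_def
proof (intro allI impI)
  fix \<tau> assume \<tau>: "transversal \<tau>"
  then have V: "\<tau> t \<in> V" if "t \<in> A" for t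
    using that by (simp add: transversal_def)
  have inj: "inj_on (\<lambda>t. c (\<tau> t)) A"
    using proper[OF V V transversal_diffs[OF \<tau>]] by (meson inj_onI)
  have "(\<lambda>t. c (\<tau> t)) ` A = A"
    using c V by (intro endo_inj_surj[OF finite_A _ inj]) auto
  then obtain t where t: "t \<in> A" "c (\<tau> t) = s"
    using s by force
  then have "{t \<in> A. \<tau> t \<in> {x \<in> V. c x = s}} = {t}"
    using V inj by (auto simp: inj_on_def)
  then show "card {t \<in> A. \<tau> t \<in> {x \<in> V. c x = s}} = 1"
    by simp
qed

text \<open>The colour classes are hyperplanes by \<open>exact_dictator\<close>. Hyperplanes in
  different directions meet while colour classes do not, so one coordinate serves for all
  colours.\<close>

lemma colouring_dictator:
  assumes c: "\<And>x. x \<in> V \<Longrightarrow> c x \<in> A"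
    and proper: "\<And>x y. \<lbrakk>x \<in> V; y \<in> V; diffs x y = I\<rbrakk> \<Longrightarrow> c x \<noteq> c y"
    and A: "card A \<ge> 3" and "I \<noteq> {}"
  shows "\<exists>i\<in>I. \<forall>x\<in>V. \<forall>y\<in>V. c x = c y \<longleftrightarrow> x i = y i"
proof -
  have "\<exists>i a. i \<in> I \<and> a \<in> A \<and> (\<forall>x\<in>V. c x = s \<longleftrightarrow> x i = a)" if "s \<in> A" for s
  proof -
    have "\<exists>i\<in>I. \<exists>a\<in>A. {x \<in> V. c x = s} = {x \<in> V. x i = a}"
      using colour_class_exact[OF c proper that] A \<open>I \<noteq> {}\<close> by (intro exact_dictator) auto
    then show ?thesis by blast
  qed
  then obtain \<iota> \<alpha> where
    class_eq: "\<And>s. s \<in> A \<Longrightarrow> \<iota> s \<in> I \<and> \<alpha> s \<in> A \<and> (\<forall>x\<in>V. c x = s \<longleftrightarrow> x (\<iota> s) = \<alpha> s)"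
    by metis
  then have iff: "c x = s \<longleftrightarrow> x (\<iota> s) = \<alpha> s" if "s \<in> A" "x \<in> V" for s x
    using that by blast
  obtain r where r: "r \<in> A"
    using A_nonempty by auto
  have \<iota>: "\<iota> s = \<iota> r" if s: "s \<in> A" for s
  proof (rule ccontr)
    assume neq: "\<iota> s \<noteq> \<iota> r"
    then obtain x where "x \<in> V" "x (\<iota> s) = \<alpha> s" "x (\<iota> r) = \<alpha> r"
      using ex_word_two_coordinates class_eq r s by metis
    then have "c x = s" "c x = r"
      using iff r s by auto
    with neq show False by simp
  qed
  have "c x = c y \<longleftrightarrow> x (\<iota> r) = y (\<iota> r)" if "x \<in> V" "y \<in> V" for x y
    using iff[OF c[OF that(1)] that(1)] iff[OF c[OF that(1)] that(2)] \<iota>[OF c[OF that(1)]] by metis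
  then show ?thesis
    using class_eq[OF r] by blast
qed

text \<open>Each coordinate of \<open>f\<close> is a proper colouring of \<Delta>, hence equivalent
  to a single coordinate of the argument. If \<open>S\<close> collects these, two words have the
  same image iff they agree on \<open>S\<close>, and a layer over \<open>S\<close> contains each
  pattern on \<open>S\<close> once.\<close>

lemma opposite_endo_bij_on_layers:
  assumes f_V: "\<And>x. x \<in> V \<Longrightarrow> f x \<in> V"
    and f_adj: "\<And>x y. \<lbrakk>x \<in> V; y \<in> V; diffs x y = I\<rbrakk> \<Longrightarrow> diffs (f x) (f y) = I"
    and A: "card A \<ge> 3"
  shows "\<exists>S\<subseteq>I. (I \<noteq> {} \<longrightarrow> S \<noteq> {}) \<and> (\<forall>z\<in>V. bij_betw f (layer S z) (f ` V))"
proof -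
  have "\<exists>i\<in>I. \<forall>x\<in>V. \<forall>y\<in>V. f x p = f y p \<longleftrightarrow> x i = y i" if p: "p \<in> I" for p
  proof (rule colouring_dictator)
    show "f x p \<noteq> f y p" if "x \<in> V" "y \<in> V" "diffs x y = I" for x y
      using f_adj[OF that] p by (auto simp: diffs_def)
  qed (use f_V V_nth_mem p A in auto)
  then obtain \<psi> where
    \<psi>: "\<And>p. p \<in> I \<Longrightarrow> \<psi> p \<in> I \<and> (\<forall>x\<in>V. \<forall>y\<in>V. f x p = f y p \<longleftrightarrow> x (\<psi> p) = y (\<psi> p))"
    by metis
  define S where "S = \<psi> ` I"
  have S: "S \<subseteq> I"
    using \<psi> by (auto simp: S_def)
  have f_eq: "f x = f y \<longleftrightarrow> (\<forall>i\<in>S. x i = y i)" if "x \<in> V" "y \<in> V" for x y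
  proof
    assume "f x = f y"
    then show "\<forall>i\<in>S. x i = y i"
      using \<psi> that unfolding S_def by (metis imageE)
  next
    assume "\<forall>i\<in>S. x i = y i"
    then have "f x p = f y p" if "p \<in> I" for p
      using \<psi> that \<open>x \<in> V\<close> \<open>y \<in> V\<close> unfolding S_def by (metis imageI)
    then show "f x = f y"
      by (rule V_eqI[OF f_V[OF that(1)] f_V[OF that(2)]])
  qed
  have "bij_betw f (layer S z) (f ` V)" if z: "z \<in> V" for z
  proof (rule bij_betw_imageI)
    show "inj_on f (layer S z)"
    proof (rule inj_onI)
      fix x y assume x: "x \<in> layer S z" and y: "y \<in> layer S z" and "f x = f y"
      then have V: "x \<in> V" "y \<in> V" and "\<forall>i\<in>S. x i = y i"
        using f_eq layer_subset_V by blast+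
      moreover have "x i = y i" if "i \<in> I - S" for i
        using x y that by (metis in_layer_iff)
      ultimately show "x = y"
        by (intro V_eqI) auto
    qed
    have "f w \<in> f ` layer S z" if w: "w \<in> V" for w
    proof -
      define x where "x i = (if i \<in> S then w i else z i)" for i
      have x: "x \<in> V"
        using w z S by (auto simp: x_def V_def PiE_def extensional_def)
      then have "f x = f w"
        using f_eq w by (simp add: x_def)
      moreover have "x \<in> layer S z"
        using x by (simp add: in_layer_iff x_def)
      ultimately show ?thesis by (metis imageI)
    qed
    then show "f ` layer S z = f ` V"
      using layer_subset_V by blast
  qed
  with S show ?thesis
    by (intro exI[of _ S]) (auto simp: S_def)
qed

end

section \<open>Endomorphisms of the complement of the opposite graph\<close>

text \<open>The addition table of the cyclic group of order \<open>card A\<close>, transported along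
  a bijection.\<close>

lemma ex_latin_square:
  assumes "finite A" "A \<noteq> {}"
  shows "\<exists>L. (\<forall>t\<in>A. bij_betw (L t) A A) \<and> (\<forall>a\<in>A. bij_betw (\<lambda>t. L t a) A A)"
proof -
  define G where "G = integer_mod_group (card A)"
  interpret G: comm_group G
    by (simp add: G_def)
  have "card A > 0"
    using assms by (simp add: card_gt_0_iff)
  then have "finite (carrier G)" "card A = card (carrier G)"
    by (simp_all add: G_def carrier_integer_mod_group)
  then obtain h where h: "bij_betw h A (carrier G)"
    using assms(1) finite_same_card_bij by blast
  define k where "k = inv_into A h"
  have k: "bij_betw k (carrier G) A"
    unfolding k_def using h by (rule bij_betw_inv_into)
  define L where "L t a = k (h t \<otimes>\<^bsub>G\<^esub> h a)" for t a
  have "bij_betw (L t) A A" if "t \<in> A" for t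
  proof -
    have "h t \<in> carrier G"
      using h that by (auto simp: bij_betw_def)
    then have "bij_betw (\<lambda>x. h t \<otimes>\<^bsub>G\<^esub> x) (carrier G) (carrier G)"
      by (simp add: bij_betw_def G.inj_on_cmult G.surj_const_mult)
    from bij_betw_trans[OF bij_betw_trans[OF h this] k] show ?thesis
      by (simp add: comp_def L_def[abs_def])
  qed
  moreover have "L t a = L a t" if "t \<in> A" "a \<in> A" for t a
    using bij_betwE[OF h] that by (simp add: L_def G.m_comm)
  then have "bij_betw (\<lambda>t. L t a) A A \<longleftrightarrow> bij_betw (L a) A A" if "a \<in> A" for a
    using that by (intro bij_betw_cong) simp
  ultimately show ?thesis by blast
qed

context words
begin

text \<open>
  Equality in the bound \<open>card F \<le> card A ^ (card I - 1)\<close> is attained on average over a family of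
  transversals covering all words equally often, hence on each of them.
\<close>
lemma exact_if_card:
  assumes F: "F \<subseteq> V" "card F * card A = card V"
    and intersecting: "\<And>x y. \<lbrakk>x \<in> F; y \<in> F; x \<noteq> y\<rbrakk> \<Longrightarrow> diffs x y \<noteq> I"
  shows "exact F"
  unfolding exact_def
proof (intro allI impI)
  fix \<tau> assume \<tau>: "transversal \<tau>"
  obtain L where L: "\<And>t. t \<in> A \<Longrightarrow> bij_betw (L t) A A" "\<And>a. a \<in> A \<Longrightarrow> bij_betw (\<lambda>t. L t a) A A"
    using ex_latin_square[OF finite_A A_nonempty] by blast
  have LA: "L t a \<in> A" if "t \<in> A" "a \<in> A" for t a
    using L(1)[OF that(1)] that(2) by (auto simp: bij_betw_def)
  \<comment> \<open>\<open>\<sigma> v\<close> is \<open>\<tau>\<close> with the parameter permuted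
    separately in each coordinate. For fixed \<open>t\<close> it runs through every word once as
    \<open>v\<close> varies, and constant \<open>v\<close> gives back \<open>\<tau>\<close> up to
    the order of its members.\<close>
  define \<sigma> where "\<sigma> v t = (\<lambda>i\<in>I. \<tau> (L t (v i)) i)" for v t
  have \<tau>b: "bij_betw (\<lambda>t. \<tau> t i) A A" if "i \<in> I" for i
    using \<tau> that by (simp add: transversal_def)
  have \<sigma>V: "\<sigma> v t \<in> V" if "v \<in> V" "t \<in> A" for v t
    using that \<tau> LA V_nth_mem by (auto simp: \<sigma>_def transversal_def V_def)
  have \<sigma>_trans: "transversal (\<sigma> v)" if v: "v \<in> V" for v
    unfolding transversal_def
  proof (intro conjI ballI)
    fix i assume i: "i \<in> I"
    from bij_betw_trans[OF L(2)[OF V_nth_mem[OF v i]] \<tau>b[OF i]]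
    show "bij_betw (\<lambda>t. \<sigma> v t i) A A"
      using i by (simp add: \<sigma>_def comp_def)
  qed (rule \<sigma>V[OF v])
  have \<sigma>_bij: "bij_betw (\<lambda>v. \<sigma> v t) V V" if t: "t \<in> A" for t
  proof -
    have "inj_on (\<lambda>v. \<sigma> v t) V"
    proof (rule inj_onI)
      fix v w assume v: "v \<in> V" and w: "w \<in> V" and eq: "\<sigma> v t = \<sigma> w t"
      show "v = w"
      proof (rule V_eqI[OF v w])
        fix i assume i: "i \<in> I"
        have "\<tau> (L t (v i)) i = \<tau> (L t (w i)) i"
          using fun_cong[OF eq, of i] i by (simp add: \<sigma>_def)
        then have "L t (v i) = L t (w i)"
          using \<tau>b[OF i] LA[OF t V_nth_mem[OF v i]] LA[OF t V_nth_mem[OF w i]]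
          by (auto simp: bij_betw_def dest: inj_onD)
        then show "v i = w i"
          using L(1)[OF t] V_nth_mem[OF v i] V_nth_mem[OF w i]
          by (auto simp: bij_betw_def dest: inj_onD)
      qed
    qed
    moreover have "(\<lambda>v. \<sigma> v t) ` V \<subseteq> V"
      using \<sigma>V t by blast
    ultimately show ?thesis
      using endo_inj_surj[OF finite_V] by (auto simp: bij_betw_def)
  qed
  define N where "N v = card {t \<in> A. \<sigma> v t \<in> F}" for v
  have N_le: "N v \<le> 1" if v: "v \<in> V" for v
  proof -
    have "s = t" if "s \<in> A" "t \<in> A" "\<sigma> v s \<in> F" "\<sigma> v t \<in> F" for s t
    proof (rule ccontr)
      assume "s \<noteq> t"
      then have *: "diffs (\<sigma> v s) (\<sigma> v t) = I"
        using transversal_diffs[OF \<sigma>_trans[OF v]] that by blast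
      then have "\<sigma> v s = \<sigma> v t"
        using intersecting that by blast
      \<comment> \<open>Only for empty \<open>I\<close> do equal words differ everywhere; then there
        is just one word, and the size condition leaves a single letter.\<close>
      with * have "I = {}"
        by (auto simp: diffs_def)
      then have "V = {\<lambda>_. undefined}"
        unfolding V_def by simp
      then have "card F * card A = 1"
        using F(2) by simp
      then have "card A = 1"
        by simp
      with that \<open>s \<noteq> t\<close> show False
        by (auto simp: card_1_singleton_iff)
    qed
    then show ?thesis
      using finite_A by (simp add: N_def card_le_Suc0_iff_eq)
  qed
  \<comment> \<open>Each of the \<open>card A\<close> choices of \<open>t\<close> contributes
    \<open>card F\<close> to the sum, so the numbers \<open>N v\<close>, all at most 1, average
    1.\<close>
  have "(\<Sum>v\<in>V. N v) = (\<Sum>v\<in>V. \<Sum>t\<in>A. of_bool (\<sigma> v t \<in> F))"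
    using finite_A by (intro sum.cong refl) (simp add: N_def Int_def)
  also have "\<dots> = (\<Sum>t\<in>A. \<Sum>v\<in>V. of_bool (\<sigma> v t \<in> F))"
    by (rule sum.swap)
  also have "\<dots> = (\<Sum>t\<in>A. \<Sum>v\<in>V. of_bool (v \<in> F))"
    using \<sigma>_bij by (intro sum.cong refl sum.reindex_bij_betw)
  also have "\<dots> = (\<Sum>v\<in>V. 1)"
    using finite_V F by (simp add: Int_absorb1 mult.commute)
  finally have eq: "(\<Sum>v\<in>V. N v) = (\<Sum>v\<in>V. 1)" .
  have N: "N v = 1" if "v \<in> V" for v
  proof (rule ccontr)
    assume "N v \<noteq> 1"
    then have "N v < 1"
      using N_le[OF that] by simp
    then have "(\<Sum>v\<in>V. N v) < (\<Sum>v\<in>V. 1)"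
      using N_le that by (intro sum_strict_mono_ex1 finite_V) auto
    with eq show False by simp
  qed
  obtain a where a: "a \<in> A"
    using A_nonempty by auto
  have \<sigma>a: "\<sigma> (\<lambda>i\<in>I. a) t = \<tau> (L t a)" if "t \<in> A" for t
    using \<tau> LA[OF that a] by (auto simp: \<sigma>_def transversal_def V_def PiE_def extensional_def)
  have "(\<lambda>t. L t a) ` {t \<in> A. \<tau> (L t a) \<in> F} = {t \<in> A. \<tau> t \<in> F}"
    using L(2)[OF a] by (auto simp: bij_betw_def)
  moreover have inj: "inj_on (\<lambda>t. L t a) {t \<in> A. \<tau> (L t a) \<in> F}"
    using L(2)[OF a] by (auto simp: bij_betw_def inj_on_def)
  ultimately have "card {t \<in> A. \<tau> t \<in> F} = card {t \<in> A. \<tau> (L t a) \<in> F}"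
    using card_image[OF inj] by simp
  also have "\<dots> = N (\<lambda>i\<in>I. a)"
    unfolding N_def using \<sigma>a by (intro arg_cong[where f = card]) auto
  finally show "card {t \<in> A. \<tau> t \<in> F} = 1"
    using N a by (simp add: V_def)
qed

section \<open>Hyperplanes and their intersections\<close>

definition hyper :: "'i \<Rightarrow> 'a \<Rightarrow> ('i \<Rightarrow> 'a) set" where
  "hyper i a = {x \<in> V. x i = a}"

lemma hyper_eq_layer: "x \<in> V \<Longrightarrow> i \<in> I \<Longrightarrow> hyper i (x i) = layer (I - {i}) x"
  by (auto simp: hyper_def in_layer_iff)

lemma hyper_nonempty:
  assumes "i \<in> I" "a \<in> A"
  shows "hyper i a \<noteq> {}"
proof -
  obtain z where "z \<in> V" using ex_V by auto
  then have "z(i := a) \<in> V"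
    using assms by (intro upd_in_V)
  then show ?thesis
    by (auto simp: hyper_def intro!: exI[of _ "z(i := a)"])
qed

lemma card_hyper_Int:
  assumes "i \<in> I" "j \<in> I" "i \<noteq> j" "a \<in> A" "b \<in> A"
  shows "card (hyper i a \<inter> hyper j b) = card A ^ (card I - 2)"
proof -
  obtain x where x: "x \<in> V" "x i = a" "x j = b"
    using ex_word_two_coordinates[OF assms] by blast
  then have "hyper i a \<inter> hyper j b = layer (I - {i, j}) x"
    using assms by (auto simp: hyper_def in_layer_iff)
  moreover have "card (I - {i, j}) = card I - 2"
    using assms finite_I by (simp add: card_Diff_subset)
  ultimately show ?thesis
    using card_layer[of "I - {i, j}" x] x by simp
qed

lemma card_hyper:
  assumes "i \<in> I" "a \<in> A"
  shows "card (hyper i a) * card A = card V"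
proof -
  obtain z where "z \<in> V" using ex_V by auto
  then have z: "z(i := a) \<in> V"
    using assms by (intro upd_in_V)
  have "card (hyper i a) = card A ^ (card I - 1)"
    using hyper_eq_layer[OF z assms(1)] card_layer[of "I - {i}", OF _ z] assms by auto
  moreover have "card I = Suc (card I - 1)"
    using assms finite_I by (metis Suc_diff_1 card_gt_0_iff empty_iff)
  ultimately show ?thesis
    by (metis card_V power_Suc2)
qed

lemma hyper_Int_hyper_eq_empty_iff:
  assumes "i \<in> I" "j \<in> I" "a \<in> A" "b \<in> A"
  shows "hyper i a \<inter> hyper j b = {} \<longleftrightarrow> i = j \<and> a \<noteq> b"
proof (cases "i = j")
  case True
  then show ?thesis
    using hyper_nonempty[OF assms(1,3)] by (auto simp: hyper_def)
next
  case False
  then show ?thesis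
    using ex_word_two_coordinates[OF assms(1,2) _ assms(3,4)] by (auto simp: hyper_def)
qed

lemma diffs_neq_I: "i \<in> I \<Longrightarrow> x i = y i \<Longrightarrow> diffs x y \<noteq> I"
  by (auto simp: diffs_def)

end

locale agreeing_endo = words +
  fixes f
  assumes f_V: "\<And>x. x \<in> V \<Longrightarrow> f x \<in> V"
    and f_adj: "\<And>x y. \<lbrakk>x \<in> V; y \<in> V; x \<noteq> y; diffs x y \<noteq> I\<rbrakk> \<Longrightarrow> f x \<noteq> f y \<and> diffs (f x) (f y) \<noteq> I"
    and card_A: "card A \<ge> 3" and card_I: "card I \<ge> 2"
begin

text \<open>Hyperplanes are cliques of the complement of \<Delta>, and endomorphisms are injective
  on cliques.\<close>

lemma inj_on_hyper: "i \<in> I \<Longrightarrow> inj_on f (hyper i a)"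
proof (rule inj_onI, rule ccontr)
  fix x y assume "i \<in> I" "x \<in> hyper i a" "y \<in> hyper i a" "f x = f y" "x \<noteq> y"
  then show False
    using f_adj[of x y] diffs_neq_I[of i x y] by (auto simp: hyper_def)
qed

lemma image_hyper:
  assumes i: "i \<in> I" and a: "a \<in> A"
  shows "\<exists>j\<in>I. \<exists>b\<in>A. f ` hyper i a = hyper j b"
proof -
  have "exact (f ` hyper i a)"
  proof (rule exact_if_card)
    show "card (f ` hyper i a) * card A = card V"
      using card_image[OF inj_on_hyper[OF i]] card_hyper[OF i a] by simp
    fix x y assume "x \<in> f ` hyper i a" "y \<in> f ` hyper i a" "x \<noteq> y"
    then obtain u v where "u \<in> hyper i a" "v \<in> hyper i a" "u \<noteq> v" "x = f u" "y = f v"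
      by blast
    then show "diffs x y \<noteq> I"
      using f_adj[of u v] diffs_neq_I[of i u v] i by (auto simp: hyper_def)
  qed (use f_V in \<open>auto simp: hyper_def\<close>)
  then have "\<exists>j\<in>I. \<exists>b\<in>A. f ` hyper i a = {x \<in> V. x j = b}"
    using f_V i by (intro exact_dictator card_A) (auto simp: hyper_def)
  then show ?thesis
    by (simp add: hyper_def)
qed

text \<open>
  If \<open>f\<close> maps the crossing hyperplanes \<open>P\<close>, \<open>Q\<close> to distinct hyperplanes, then by cardinality
  \<open>f ` (P \<inter> Q)\<close> is all of \<open>f ` P \<inter> f ` Q\<close>.
\<close>
lemma image_hyper_Int:
  assumes i: "i \<in> I" and j: "j \<in> I" and ij: "i \<noteq> j" and a: "a \<in> A" and c: "c \<in> A"
    and neq: "f ` hyper i a \<noteq> f ` hyper j c"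
  shows "f ` (hyper i a \<inter> hyper j c) = f ` hyper i a \<inter> f ` hyper j c"
proof -
  obtain i' a' where P: "i' \<in> I" "a' \<in> A" "f ` hyper i a = hyper i' a'"
    using image_hyper[OF i a] by blast
  obtain j' c' where Q: "j' \<in> I" "c' \<in> A" "f ` hyper j c = hyper j' c'"
    using image_hyper[OF j c] by blast
  have "f ` hyper i a \<inter> f ` hyper j c \<noteq> {}"
    using hyper_Int_hyper_eq_empty_iff[OF i j a c] ij by blast
  then have "i' \<noteq> j'"
    using neq P Q hyper_Int_hyper_eq_empty_iff[OF P(1) Q(1) P(2) Q(2)] by auto
  then have card: "card (f ` hyper i a \<inter> f ` hyper j c) = card A ^ (card I - 2)"
    using card_hyper_Int[OF P(1) Q(1) _ P(2) Q(2)] P(3) Q(3) by simp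
  have "inj_on f (hyper i a \<inter> hyper j c)"
    using inj_on_hyper[OF i] by (rule inj_on_subset) auto
  then have "card (f ` (hyper i a \<inter> hyper j c)) = card A ^ (card I - 2)"
    using card_image card_hyper_Int[OF i j ij a c] by metis
  with card show ?thesis
    using finite_V by (intro card_subset_eq) (auto simp: hyper_def)
qed

text \<open>The images of the two parallel hyperplanes have directions other than that of the image
  of \<open>hyper i a\<close>, so a common point \<open>x\<close> could be moved into the latter
  without leaving them. By \<open>image_hyper_Int\<close> the new point would come from
  \<open>hyper i a\<close> intersected with either hyperplane, although \<open>f\<close> is
  injective on \<open>hyper i a\<close> and the two are disjoint.\<close>

lemma images_disjoint:
  assumes i: "i \<in> I" and j: "j \<in> I" and ij: "i \<noteq> j" and a: "a \<in> A"
    and c: "c \<in> A" and d: "d \<in> A" and cd: "c \<noteq> d"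
    and neq: "f ` hyper j c \<noteq> f ` hyper i a" "f ` hyper j d \<noteq> f ` hyper i a"
  shows "f ` hyper j c \<inter> f ` hyper j d = {}"
proof (rule ccontr)
  assume meet: "f ` hyper j c \<inter> f ` hyper j d \<noteq> {}"
  obtain i' a' where P: "i' \<in> I" "a' \<in> A" "f ` hyper i a = hyper i' a'"
    using image_hyper[OF i a] by blast
  obtain j' c' where Q: "j' \<in> I" "c' \<in> A" "f ` hyper j c = hyper j' c'"
    using image_hyper[OF j c] by blast
  obtain k d' where R: "k \<in> I" "d' \<in> A" "f ` hyper j d = hyper k d'"
    using image_hyper[OF j d] by blast
  have "hyper i a \<inter> hyper j c \<noteq> {}" "hyper i a \<inter> hyper j d \<noteq> {}"
    using ij hyper_Int_hyper_eq_empty_iff[OF i j a] c d by simp_all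
  then have "hyper i' a' \<inter> hyper j' c' \<noteq> {}" "hyper i' a' \<inter> hyper k d' \<noteq> {}"
    using P(3) Q(3) R(3) by blast+
  then have dirs: "i' \<noteq> j'" "i' \<noteq> k"
    using neq P Q R hyper_Int_hyper_eq_empty_iff by auto
  obtain x where x: "x \<in> V" "x j' = c'" "x k = d'"
    using meet unfolding Q(3) R(3) by (auto simp: hyper_def)
  have "x(i' := a') \<in> f ` hyper i a \<inter> f ` hyper j c" "x(i' := a') \<in> f ` hyper i a \<inter> f ` hyper j d"
    unfolding P(3) Q(3) R(3) using x dirs upd_in_V[OF x(1) P(1,2)] by (auto simp: hyper_def)
  then have "x(i' := a') \<in> f ` (hyper i a \<inter> hyper j c) \<inter> f ` (hyper i a \<inter> hyper j d)"
    using image_hyper_Int[OF i j ij a c neq(1)[symmetric]]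
      image_hyper_Int[OF i j ij a d neq(2)[symmetric]] by blast
  then show False
    using inj_on_hyper[OF i, of a] cd by (auto simp: inj_on_def hyper_def)
qed

lemma image_hyper_nonempty: "i \<in> I \<Longrightarrow> a \<in> A \<Longrightarrow> f ` hyper i a \<noteq> {}"
  using hyper_nonempty by simp

text \<open>Otherwise \<open>images_disjoint\<close> would make a nonempty image disjoint from
  itself.\<close>

lemma image_hypers_eq_if_repeated:
  assumes i: "i \<in> I" and j: "j \<in> I" and ij: "i \<noteq> j" and a: "a \<in> A"
    and c: "c \<in> A" and d: "d \<in> A" and cd: "c \<noteq> d" and eq: "f ` hyper j c = f ` hyper j d"
  shows "f ` hyper i a = f ` hyper j c"
proof (rule ccontr)
  assume "\<not> ?thesis"
  then have "f ` hyper j c \<noteq> f ` hyper i a" "f ` hyper j d \<noteq> f ` hyper i a"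
    using eq by auto
  from images_disjoint[OF i j ij a c d cd this] show False
    using eq image_hyper_nonempty[OF j c] by simp
qed

text \<open>\<open>x\<close> and \<open>y\<close> differ everywhere. If their hyperplanes in
  direction \<open>i\<close> have different images, these meet in \<open>f x\<close>, so by
  \<open>images_disjoint\<close> every hyperplane in direction \<open>j\<close> has one of these two
  images. Three letters then force a repetition.\<close>

lemma repeated_hyper_image:
  assumes i: "i \<in> I" and j: "j \<in> I" and ij: "i \<noteq> j"
    and x: "x \<in> V" and y: "y \<in> V" and xy: "x \<noteq> y" "f x = f y"
  shows "\<exists>k\<in>{i, j}. \<exists>c\<in>A. \<exists>d\<in>A. c \<noteq> d \<and> f ` hyper k c = f ` hyper k d"
proof (cases "f ` hyper i (x i) = f ` hyper i (y i)")
  case True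
  have "x i \<noteq> y i"
    using f_adj[OF x y] xy i by (auto simp: diffs_def)
  with True show ?thesis
    using V_nth_mem[OF x i] V_nth_mem[OF y i] by blast
next
  case False
  have "x i \<noteq> y i"
    using False by auto
  have meet: "f ` hyper i (x i) \<inter> f ` hyper i (y i) \<noteq> {}"
    using x y xy(2) by (auto simp: hyper_def intro!: image_eqI)
  have two: "f ` hyper j c \<in> {f ` hyper i (x i), f ` hyper i (y i)}" if "c \<in> A" for c
    using images_disjoint[OF j i ij[symmetric] that V_nth_mem[OF x i] V_nth_mem[OF y i] \<open>x i \<noteq> y i\<close>] meet
    by auto
  have "\<not> inj_on (\<lambda>c. f ` hyper j c) A"
  proof
    assume inj: "inj_on (\<lambda>c. f ` hyper j c) A"
    have "(\<lambda>c. f ` hyper j c) ` A \<subseteq> {f ` hyper i (x i), f ` hyper i (y i)}"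
      using two by (rule image_subsetI)
    from card_inj_on_le[OF inj this] have "card A \<le> card {f ` hyper i (x i), f ` hyper i (y i)}"
      by simp
    with card_A show False
      by (simp add: card_insert_if split: if_splits)
  qed
  then show ?thesis
    by (auto simp: inj_on_def)
qed

lemma image_hyper_if_singular:
  assumes "\<not> inj_on f V"
  shows "\<exists>i\<in>I. \<exists>j\<in>I. \<exists>b\<in>A. f ` V = hyper j b \<and> (\<forall>z\<in>V. bij_betw f (layer (I - {i}) z) (f ` V))"
proof -
  obtain x y where xy: "x \<in> V" "y \<in> V" "x \<noteq> y" "f x = f y"
    using assms by (auto simp: inj_on_def)
  obtain i where i: "i \<in> I"
    using card_I by (metis all_not_in_conv card.empty not_numeral_le_zero)
  have "\<not> I \<subseteq> {i}"
    using card_I card_mono[of "{i}" I] by auto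
  then obtain j where j: "j \<in> I" "i \<noteq> j"
    by auto
  obtain k c d where k: "k \<in> {i, j}" "c \<in> A" "d \<in> A" "c \<noteq> d" "f ` hyper k c = f ` hyper k d"
    using repeated_hyper_image[OF i j xy] by blast
  \<comment> \<open>The hyperplanes in the other direction \<open>l\<close> partition
    \<open>V\<close> and by \<open>image_hypers_eq_if_repeated\<close> share one image, which is
    then the image of \<open>f\<close>.\<close>
  define l where "l = (if k = i then j else i)"
  have kl: "k \<in> I" "l \<in> I" "l \<noteq> k"
    using k i j by (auto simp: l_def)
  have *: "f ` hyper l a = f ` hyper k c" if "a \<in> A" for a
    using image_hypers_eq_if_repeated[OF kl(2,1,3) that k(2-5)] .
  have "V = (\<Union>a\<in>A. hyper l a)"
    using V_nth_mem kl by (auto simp: hyper_def)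
  then have V: "f ` V = f ` hyper k c"
    using * A_nonempty by (auto simp: image_UN)
  have "bij_betw f (layer (I - {l}) z) (f ` V)" if z: "z \<in> V" for z
    unfolding bij_betw_def
    using inj_on_hyper[OF kl(2), of "z l"] *[OF V_nth_mem[OF z kl(2)]] V hyper_eq_layer[OF z kl(2)] by simp
  moreover have "\<exists>j\<in>I. \<exists>b\<in>A. f ` V = hyper j b"
    unfolding V by (rule image_hyper[OF kl(1) k(2)])
  ultimately show ?thesis
    using kl(2) by blast
qed

end

section \<open>The group \<open>\<int>\<^sub>n\<^sup>m\<close>\<close>

lemma carrier_Zn_pow: "n \<ge> 1 \<Longrightarrow> carrier (Zn_pow m n) = {..<m} \<rightarrow>\<^sub>E {0..<int n}"
  by (simp add: Zn_pow_def carrier_integer_mod_group)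

lemma generate_std_tuples:
  assumes n: "n \<ge> 1" and R: "R \<subseteq> {..<m}"
  shows "generate (Zn_pow m n) (std_tuple m n ` R)
       = {x \<in> carrier (Zn_pow m n). \<forall>i\<in>{..<m} - R. x i = 0}" (is "?G = ?X")
proof
  have tuple: "std_tuple m n i \<in> ?X" if "i \<in> R" for i
    using that n by (auto simp: std_tuple_def carrier_Zn_pow[OF n])
  show "?G \<subseteq> ?X"
  proof
    fix x assume "x \<in> ?G"
    then show "x \<in> ?X"
    proof induction
      case one
      then show ?case
        using n by (auto simp: Zn_pow_def carrier_integer_mod_group)
    next
      case (incl h)
      then show ?case using tuple by auto
    next
      case (inv h)
      then have h: "h \<in> ?X" using tuple by auto
      then have "inv\<^bsub>Zn_pow m n\<^esub> h = (\<lambda>i\<in>{..<m}. inv\<^bsub>integer_mod_group n\<^esub> (h i))"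
        unfolding Zn_pow_def by (intro inv_product_group) auto
      also have "\<dots> = (\<lambda>i\<in>{..<m}. (- h i) mod int n)"
        using h by (intro restrict_ext inv_integer_mod_group) (auto simp: Zn_pow_def)
      finally show ?case
        using h n by (auto simp: carrier_Zn_pow[OF n])
    next
      case (eng g h)
      then show ?case
        using n by (auto simp: Zn_pow_def carrier_integer_mod_group)
    qed
  qed
  show "?X \<subseteq> ?G"
  proof
    fix x assume "x \<in> ?X"
    then show "x \<in> ?G"
    \<comment> \<open>Induction on the sum of the representatives: lower a nonzero coordinate by 1
      and add \<open>std_tuple\<close> back.\<close>
    proof (induction "\<Sum>i\<in>R. nat (x i)" arbitrary: x rule: less_induct)
      case less
      have x: "x \<in> {..<m} \<rightarrow>\<^sub>E {0..<int n}" "\<And>i. i < m \<Longrightarrow> i \<notin> R \<Longrightarrow> x i = 0"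
        using less.prems by (auto simp: carrier_Zn_pow[OF n])
      show ?case
      proof (cases "\<exists>i\<in>R. x i \<noteq> 0")
        case False
        then have "x = \<one>\<^bsub>Zn_pow m n\<^esub>"
          using x by (auto simp: Zn_pow_def fun_eq_iff PiE_def extensional_def)
        then show ?thesis
          by (simp add: generate.one)
      next
        case True
        then obtain i where i: "i \<in> R" "x i \<noteq> 0" by auto
        have im: "i < m" using i R by auto
        then have xi: "0 < x i" "x i < int n"
          using x(1) i(2) by (auto simp: PiE_def Pi_def order_less_le)
        define y where "y = x(i := x i - 1)"
        have y: "y \<in> {..<m} \<rightarrow>\<^sub>E {0..<int n}"
          using x(1) xi im by (auto simp: y_def PiE_def Pi_def extensional_def)
        have "finite R"
          using R finite_subset by blast
        then have "(\<Sum>j\<in>R. nat (y j)) < (\<Sum>j\<in>R. nat (x j))"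
          using i(1) xi by (intro sum_strict_mono_ex1) (auto simp: y_def)
        moreover have "y \<in> ?X"
          using y x(2) i(1) by (auto simp: y_def carrier_Zn_pow[OF n])
        ultimately have "y \<in> ?G"
          using less.hyps by blast
        then have "std_tuple m n i \<otimes>\<^bsub>Zn_pow m n\<^esub> y \<in> ?G"
          using i(1) by (intro generate.eng[OF generate.incl]) auto
        moreover have "std_tuple m n i \<otimes>\<^bsub>Zn_pow m n\<^esub> y = x"
        proof
          fix j
          show "(std_tuple m n i \<otimes>\<^bsub>Zn_pow m n\<^esub> y) j = x j"
          proof (cases "j < m")
            case True
            then have "0 \<le> x j" "x j < int n"
              using x(1) by (auto simp: PiE_def Pi_def)
            then show ?thesis
              using True xi by (auto simp: Zn_pow_def std_tuple_def y_def)
          next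
            case False
            then show ?thesis
              using x(1) by (auto simp: Zn_pow_def PiE_def extensional_def)
          qed
        qed
        ultimately show ?thesis by simp
      qed
    qed
  qed
qed

section \<open>The four graphs in terms of words\<close>

locale Zn_words =
  fixes m n :: nat
  assumes m: "m \<ge> 2" and n: "n \<ge> 1"
begin

sublocale words "{..<m}" "{0..<int n}"
  by unfold_locales (use n in auto)

lemma index_nonempty: "{..<m} \<noteq> {}"
  using m by (auto simp: lessThan_empty_iff)

lemma carrier_eq_V: "carrier (Zn_pow m n) = V"
  using n by (simp add: V_def carrier_Zn_pow)

lemma hamming_dist_eq: "hamming_dist m x y = card (diffs x y)"
  by (simp add: hamming_dist_def diffs_def)

lemma hamming_dist_eq_m_iff: "hamming_dist m x y = m \<longleftrightarrow> diffs x y = {..<m}"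
proof -
  have "diffs x y \<subseteq> {..<m}"
    by (auto simp: diffs_def)
  then show ?thesis
    using card_subset_eq[of "{..<m}" "diffs x y"] by (auto simp: hamming_dist_eq)
qed

lemma is_layer_layer:
  assumes R: "R \<subseteq> {..<m}" and z: "z \<in> V"
  shows "is_layer m n (card R) (layer R z)"
proof -
  have "z <#\<^bsub>Zn_pow m n\<^esub> generate (Zn_pow m n) (std_tuple m n ` R) = layer R z" (is "?L = _")
  proof
    show "?L \<subseteq> layer R z"
    proof
      fix y assume "y \<in> ?L"
      then obtain h where h: "h \<in> V" "\<forall>i\<in>{..<m} - R. h i = 0"
        and y: "y = (\<lambda>i\<in>{..<m}. (z i + h i) mod int n)"
        by (auto simp: l_coset_def generate_std_tuples[OF n R] carrier_eq_V) (auto simp: Zn_pow_def)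
      have "z i mod int n = z i" if "i < m" for i
        using V_nth_mem[OF z, of i] that by simp
      then show "y \<in> layer R z"
        using h(2) n by (auto simp: y in_layer_iff V_def)
    qed
    show "layer R z \<subseteq> ?L"
    proof
      fix y assume y: "y \<in> layer R z"
      define h where "h = (\<lambda>i\<in>{..<m}. (y i - z i) mod int n)"
      have "h \<in> V"
        using n by (auto simp: h_def V_def)
      moreover have "\<forall>i\<in>{..<m} - R. h i = 0"
        using y by (auto simp: h_def in_layer_iff)
      moreover have "y = z \<otimes>\<^bsub>Zn_pow m n\<^esub> h"
      proof (rule V_eqI)
        show "y \<in> V" using y by (simp add: in_layer_iff)
        show "z \<otimes>\<^bsub>Zn_pow m n\<^esub> h \<in> V"
          using n by (auto simp: Zn_pow_def V_def)
        fix i assume i: "i \<in> {..<m}"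
        then have "y i mod int n = y i"
          using V_nth_mem[OF \<open>y \<in> V\<close> i] by simp
        with i show "y i = (z \<otimes>\<^bsub>Zn_pow m n\<^esub> h) i"
          by (simp add: Zn_pow_def h_def mod_add_right_eq)
      qed
      ultimately show "y \<in> ?L"
        by (auto simp: l_coset_def generate_std_tuples[OF n R] carrier_eq_V)
    qed
  qed
  with R z show ?thesis
    unfolding is_layer_def carrier_eq_V by blast
qed

text \<open>An injective self-map of a finite set is bijective, and for \<open>n = 1\<close> there
  is only one vertex. Together with \<open>n \<noteq> 2\<close> this leaves at least three
  letters.\<close>

lemma singular_not_inj:
  assumes "f \<in> V \<rightarrow> V" "\<not> bij_betw f V V"
  shows "\<not> inj_on f V" "n \<noteq> 1"
proof -
  show "\<not> inj_on f V"
    using assms(2) endo_inj_surj[OF finite_V funcset_image[OF assms(1)]] by (auto simp: bij_betw_def)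
  moreover have "inj_on f V" if "n = 1"
  proof -
    have "card V = 1"
      unfolding card_V using that by simp
    then show ?thesis
      by (auto simp: card_1_singleton_iff)
  qed
  ultimately show "n \<noteq> 1" by blast
qed

lemma card_less_m_if_singular:
  assumes "\<not> inj_on f V" "map_rank V f = n ^ card S" "S \<subseteq> {..<m}"
  shows "card S \<le> m - 1"
proof -
  have "card S \<noteq> m"
  proof
    assume "card S = m"
    then have "card (f ` V) = card V"
      using assms(2) by (simp add: map_rank_def card_V)
    with assms(1) show False
      using eq_card_imp_inj_on[OF finite_V] by blast
  qed
  moreover have "card S \<le> m"
    using card_mono[OF _ assms(3)] by simp
  ultimately show ?thesis by linarith
qed

text \<open>The exponent is the common size of \<open>S\<close> and \<open>R\<close>: at least 1
  because \<open>R\<close> is nonempty, at most \<open>m - 1\<close> because \<open>f\<close> is not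
  injective.\<close>

lemma singular_hamming_graph:
  assumes f: "singular_endomorphism (hamming_graph m n) f" and "n \<noteq> 2"
  shows "\<exists>k. 1 \<le> k \<and> k \<le> m - 1 \<and> uniform_map V f \<and> map_rank V f = n ^ k \<and> is_layer m n k (f ` V)"
proof -
  have fV: "f \<in> V \<rightarrow> V" and bij: "\<not> bij_betw f V V"
    and adj: "\<And>x y. \<lbrakk>x \<in> V; y \<in> V; card (diffs x y) = 1\<rbrakk> \<Longrightarrow> card (diffs (f x) (f y)) = 1"
    using f by (auto simp: singular_endomorphism_def endomorphism_def hamming_dist_graph_def
        carrier_eq_V hamming_dist_eq)
  interpret hamming_endo "{..<m}" "{0..<int n}" f
  proof
    show "\<exists>p. diffs (f x) (f y) = {p}" if "x \<in> V" "y \<in> V" "diffs x y = {i}" for x y i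
      using adj[OF that(1,2)] that(3) by (simp add: card_1_singleton_iff)
    show "card {0..<int n} \<ge> 3"
      using singular_not_inj(2)[OF fV bij] n \<open>n \<noteq> 2\<close> by simp
  qed (use fV in auto)
  obtain S R z where SR: "S \<subseteq> {..<m}" "R \<subseteq> {..<m}" "card S = card R" "z \<in> V" "R \<noteq> {}"
    and bij_layer: "\<And>x. x \<in> V \<Longrightarrow> bij_betw f (layer S x) (layer R z)"
    using bij_on_layers index_nonempty by blast
  have rank: "map_rank V f = n ^ card S"
    using map_rank_if_bij_on_layers[OF SR(1) bij_layer] by simp
  moreover have "1 \<le> card S"
    using SR finite_subset[OF SR(2)] by (simp add: Suc_le_eq card_gt_0_iff)
  moreover have "card S \<le> m - 1"
    using card_less_m_if_singular[OF singular_not_inj(1)[OF fV bij] rank SR(1)] .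
  moreover have "is_layer m n (card S) (f ` V)"
    using image_if_bij_on_layers[OF bij_layer] is_layer_layer[OF SR(2,4)] SR(3) by simp
  ultimately show ?thesis
    using uniform_map_if_bij_on_layers[OF SR(1) bij_layer] by blast
qed

lemma singular_opposite_graph:
  assumes f: "singular_endomorphism (hamming_dist_graph m n m) f" and "n \<noteq> 2"
  shows "\<exists>k. 1 \<le> k \<and> k \<le> m - 1 \<and> uniform_map V f \<and> map_rank V f = n ^ k"
proof -
  have fV: "f \<in> V \<rightarrow> V" and bij: "\<not> bij_betw f V V"
    and adj: "\<And>x y. \<lbrakk>x \<in> V; y \<in> V; diffs x y = {..<m}\<rbrakk> \<Longrightarrow> diffs (f x) (f y) = {..<m}"
    using f by (auto simp: singular_endomorphism_def endomorphism_def hamming_dist_graph_def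
        carrier_eq_V hamming_dist_eq_m_iff)
  have "card {0..<int n} \<ge> 3"
    using singular_not_inj(2)[OF fV bij] n \<open>n \<noteq> 2\<close> by simp
  from opposite_endo_bij_on_layers[of f, OF funcset_mem[OF fV] adj this]
  obtain S where S: "S \<subseteq> {..<m}" "S \<noteq> {}"
    and bij_layer: "\<And>x. x \<in> V \<Longrightarrow> bij_betw f (layer S x) (f ` V)"
    using index_nonempty by blast
  have rank: "map_rank V f = n ^ card S"
    using map_rank_if_bij_on_layers[OF S(1) bij_layer] by simp
  moreover have "1 \<le> card S"
    using S finite_subset[OF S(1)] by (simp add: Suc_le_eq card_gt_0_iff)
  moreover have "card S \<le> m - 1"
    using card_less_m_if_singular[OF singular_not_inj(1)[OF fV bij] rank S(1)] .
  ultimately show ?thesis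
    using uniform_map_if_bij_on_layers[OF S(1) bij_layer] by blast
qed

lemma adj_compl_hamming_graph_iff:
  assumes "x \<in> V" "y \<in> V"
  shows "adj (graph_compl (hamming_graph m n)) x y \<longleftrightarrow> card (diffs x y) \<ge> 2"
proof -
  have "card (diffs x y) = 0 \<longleftrightarrow> x = y"
    using diffs_empty_iff[OF assms] by (simp add: diffs_def)
  then show ?thesis
    by (auto simp: graph_compl_def hamming_dist_graph_def hamming_dist_eq)
qed

lemma singular_compl_hamming_graph:
  assumes f: "singular_endomorphism (graph_compl (hamming_graph m n)) f"
  shows "colouring_of_rank (graph_compl (hamming_graph m n)) (n ^ (m - 1)) f \<and> uniform_map V f"
proof -
  let ?G = "graph_compl (hamming_graph m n)"
  have verts: "verts ?G = V"
    by (simp add: graph_compl_def hamming_dist_graph_def carrier_eq_V)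
  have endo: "endomorphism ?G f"
    using f by (simp add: singular_endomorphism_def)
  have fV: "f \<in> V \<rightarrow> V" and bij: "\<not> bij_betw f V V"
    using f unfolding singular_endomorphism_def endomorphism_def verts by auto
  interpret far_singular_endo "{..<m}" "{0..<int n}" f
  proof
    show "card (diffs (f x) (f y)) \<ge> 2" if "x \<in> V" "y \<in> V" "card (diffs x y) \<ge> 2" for x y
      using endo that adj_compl_hamming_graph_iff funcset_mem[OF fV]
      unfolding endomorphism_def verts by blast
  qed (use fV m singular_not_inj(1)[OF fV bij] in auto)
  have "is_clique ?G (f ` V)"
    using image_far f_V adj_compl_hamming_graph_iff unfolding is_clique_def verts by blast
  then show ?thesis
    using endo rank uniform unfolding colouring_of_rank_def verts by simp
qed

lemma adj_compl_opposite_graph_iff: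
  "adj (graph_compl (hamming_dist_graph m n m)) x y \<longleftrightarrow> x \<noteq> y \<and> diffs x y \<noteq> {..<m}"
  by (simp add: graph_compl_def hamming_dist_graph_def hamming_dist_eq_m_iff)

lemma singular_compl_opposite_graph:
  assumes f: "singular_endomorphism (graph_compl (hamming_dist_graph m n m)) f" and "n \<noteq> 2"
  shows "colouring_of_rank (graph_compl (hamming_dist_graph m n m)) (n ^ (m - 1)) f \<and> uniform_map V f"
proof -
  let ?G = "graph_compl (hamming_dist_graph m n m)"
  have verts: "verts ?G = V"
    by (simp add: graph_compl_def hamming_dist_graph_def carrier_eq_V)
  have endo: "endomorphism ?G f"
    using f by (simp add: singular_endomorphism_def)
  have fV: "f \<in> V \<rightarrow> V" and bij: "\<not> bij_betw f V V"
    using f unfolding singular_endomorphism_def endomorphism_def verts by auto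
  interpret agreeing_endo "{..<m}" "{0..<int n}" f
  proof
    show "f x \<noteq> f y \<and> diffs (f x) (f y) \<noteq> {..<m}"
      if "x \<in> V" "y \<in> V" "x \<noteq> y" "diffs x y \<noteq> {..<m}" for x y
      using endo that unfolding endomorphism_def verts adj_compl_opposite_graph_iff by blast
    show "card {0..<int n} \<ge> 3"
      using singular_not_inj(2)[OF fV bij] n \<open>n \<noteq> 2\<close> by simp
  qed (use fV m in auto)
  obtain i j b where i: "i < m" and j: "j < m" "f ` V = hyper j b"
    and bij_layer: "\<And>z. z \<in> V \<Longrightarrow> bij_betw f (layer ({..<m} - {i}) z) (f ` V)"
    using image_hyper_if_singular[OF singular_not_inj(1)[OF fV bij]] by auto
  have "diffs x y \<noteq> {..<m}" if "x \<in> f ` V" "y \<in> f ` V" for x y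
    using that diffs_neq_I[of j x y] j(1) unfolding j(2) by (simp add: hyper_def)
  then have "is_clique ?G (f ` V)"
    unfolding is_clique_def verts adj_compl_opposite_graph_iff using fV by blast
  moreover have "map_rank V f = n ^ (m - 1)"
    using map_rank_if_bij_on_layers[OF _ bij_layer] i by simp
  ultimately show ?thesis
    using endo uniform_map_if_bij_on_layers[OF _ bij_layer] unfolding colouring_of_rank_def verts by blast
qed

end

theorem theorem1p2:
  fixes m n :: nat
    and \<Gamma> \<Delta> :: "(nat \<Rightarrow> int) graph"
  assumes "m \<ge> 2" and "n \<ge> 1"
  defines "\<Gamma> \<equiv> hamming_graph m n" and "\<Delta> \<equiv> hamming_dist_graph m n m"
  shows
    "(n \<noteq> 2 \<longrightarrow> (\<forall>f. singular_endomorphism \<Gamma> f \<longrightarrow>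
        (\<exists>k. 1 \<le> k \<and> k \<le> m - 1 \<and> uniform_map (verts \<Gamma>) f \<and> map_rank (verts \<Gamma>) f = n ^ k
             \<and> is_layer m n k (f ` verts \<Gamma>)))) \<and>
     (n \<noteq> 2 \<longrightarrow> (\<forall>f. singular_endomorphism \<Delta> f \<longrightarrow>
        (\<exists>k. 1 \<le> k \<and> k \<le> m - 1 \<and> uniform_map (verts \<Delta>) f \<and> map_rank (verts \<Delta>) f = n ^ k))) \<and>
     (\<forall>f. singular_endomorphism (graph_compl \<Gamma>) f \<longrightarrow>
        colouring_of_rank (graph_compl \<Gamma>) (n ^ (m - 1)) f \<and>
        uniform_map (verts (graph_compl \<Gamma>)) f) \<and>
     (n \<noteq> 2 \<longrightarrow> (\<forall>f. singular_endomorphism (graph_compl \<Delta>) f \<longrightarrow>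
        colouring_of_rank (graph_compl \<Delta>) (n ^ (m - 1)) f \<and>
        uniform_map (verts (graph_compl \<Delta>)) f))"
proof -
  interpret Zn_words m n
    using assms(1,2) by unfold_locales
  have verts: "verts (hamming_dist_graph m n d) = V"
    "verts (graph_compl (hamming_dist_graph m n d)) = V" for d
    by (simp_all add: graph_compl_def hamming_dist_graph_def carrier_eq_V)
  show ?thesis
    unfolding \<Gamma>_def \<Delta>_def verts
    using singular_hamming_graph singular_opposite_graph singular_compl_hamming_graph
      singular_compl_opposite_graph by blast
qed

end
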